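(* Let $f:\mathbb{R}^{d\times r}\to\mathbb{R}$ be twice continuously differentiable and $L$-smooth, i.e. $f(y)\le f(x)+\langle\nabla f(x),y-x\rangle+\frac{L}{2}\|y-x\|_F^2$ for all $x,y\in\mathbb{R}^{d\times r}$. Let $\mathcal{S}$ be the (nonempty) set of all local minima of $f$ on $\mathrm{St}(d,r)$ with a given value $f_{\mathcal S}^*$, normalized so that $f_{\mathcal S}^*=0$, and suppose that $f$ satisfies the local Riemannian Polyak-Łojasiewicz condition with factor $\mu>0$ and radius parameter $\delta>0$: $$|f(x)-f_{\mathcal S}^*|\le\frac{1}{2\mu}\|\mathrm{grad} f(x)\|_F^2\qquad\text{for all }x\in\mathrm{St}(d,r)\cap\mathcal{D}(\mathcal{S},2\delta).$$ Let $\epsilon\in(0,3/4)$ and $\lambda>0$, let $\gamma$ satisfy the lower bound given in the context, and let $\mathcal{L},\Lambda,\rho,L',\mu',\alpha_{safe}$ be as defined in the context. Let the initial point $x_0\in\mathcal{D}(\mathcal{S},\delta)\cap\mathrm{St}(d,r)^\epsilon$ be such that $\mathcal{L}(x_0)\le\frac{\mu'\rho^2\delta^2}{16}$, choose a step size $0<\alpha\le\min\{\frac{\rho}{L'},\alpha_{safe}\}$, and let the iterates be generated by the landing algorithm $$x_{k+1}=x_k-\alpha\Lambda(x_k),\qquad k\ge 0.$$ Then for all $k\ge 0$, $$\mathcal{L}(x_k)\le\left(1-\frac{\alpha\rho\mu'}{2}\right)^k\mathcal{L}(x_0).$$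
   Context: Notation. $\|\cdot\|_F$ is the Frobenius norm and $\langle A,B\rangle=\mathrm{Tr}(AB^\top)$. For a square matrix $A$, $\mathrm{skew}(A)=\frac12(A-A^\top)$ and $\mathrm{sym}(A)=\frac12(A+A^\top)$. $I_r$ is the $r\times r$ identity. The Stiefel manifold is $\mathrm{St}(d,r)=\{x\in\mathbb{R}^{d\times r}: x^\top x=I_r\}$. For a set $\mathcal{S}$, $\mathrm{dist}(\mathcal{S},x)=\min_{y\in\mathcal{S}}\|x-y\|_F$ and $\mathcal{D}(\mathcal{S},\delta)=\{x:\mathrm{dist}(\mathcal{S},x)\le\delta\}$. The safety region is $\mathrm{St}(d,r)^\epsilon=\{x\in\mathbb{R}^{d\times r}:\|x^\top x-I_r\|_F\le\epsilon\}$. $\nabla f$ is the Euclidean gradient. Relative (Riemannian) gradient, defined for every $x\in\mathbb{R}^{d\times r}$: $\mathrm{grad} f(x)=\mathrm{skew}(\nabla f(x)x^\top)x$. Penalty: $p(x)=\frac14\|x^\top x-I_r\|_F^2$, so $\nabla p(x)=x(x^\top x-I_r)$. Landing field: $\Lambda(x)=\mathrm{grad} f(x)+\lambda\nabla p(x)$. Merit function: $\mathcal{L}(x)=f(x)+h(x)+\gamma p(x)$ with $h(x)=-\frac12\langle\mathrm{sym}(x^\top\nabla f(x)),x^\top x-I_r\rangle$. Constants. $s=\sup_{x\in\mathrm{St}(d,r)^\epsilon}\|\mathrm{sym}(x^\top\nabla f(x))\|_F$; $\hat L=\max(L,\max_{x\in\mathrm{St}(d,r)^\epsilon}\|\nabla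 f(x)\|_F)$. The parameter $\gamma$ is required to satisfy $$\gamma\ge\frac{2}{3-4\epsilon}\left(L(1-\epsilon)+3s+\hat L^2\frac{(1+\epsilon)^2}{\lambda(1-\epsilon)}\right).$$ $\rho=\min\{\frac12,\frac{\gamma}{4\lambda(1+\epsilon)}\}$. $L_{\mathcal L}$ is a (finite) smoothness constant of $\mathcal{L}$ on $\mathrm{St}(d,r)^\epsilon$, i.e. $\mathcal{L}(y)\le\mathcal{L}(x)+\langle\nabla\mathcal{L}(x),y-x\rangle+\frac{L_{\mathcal L}}{2}\|y-x\|_F^2$ for $x,y\in\mathrm{St}(d,r)^\epsilon$. $L_\Lambda$ is a Lipschitz constant of $\Lambda$ on $\mathrm{St}(d,r)^\epsilon$. $L'=\max\{\hat L,L_\Lambda,L_{\mathcal L}\}$. The constant $\mu'$ is defined by $$\frac{1}{\mu'}=\max\left\{\frac1\mu,\frac{2(3+2\epsilon)^2\hat L^2+\mu L'}{2\mu\lambda^2(1-\epsilon)^2}\right\}.$$ $G>0$ is a constant with $\|\mathrm{grad} f(x)\|_F\le G$ for all $x\in\mathrm{St}(d,r)^\epsilon$, and $$\alpha_{safe}=\min\left\{\frac{\lambda\epsilon(1-\epsilon)}{G^2+\lambda^2(1+\epsilon)\epsilon^2},\sqrt{\frac{\epsilon}{2G^2}},\frac{1}{2\lambda}\right\}.$$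
   Formalization: "L-smooth" is taken to mean that the gradient of f is L-Lipschitz on all matrices, in addition to the displayed one-sided quadratic upper bound; with the upper bound alone the claim is false, since strong negative curvature normal to the Stiefel manifold can make the merit function increase. *)

theory Defs
  imports "HOL-Analysis.Analysis"
begin

text \<open>
  A \<open>d \<times> r\<close> real matrix has type \<^typ>\<open>real ^ 'r ^ 'd\<close>. On this type the library's
  \<^term>\<open>norm\<close> is the Frobenius norm and \<open>A \<bullet> B\<close> is \<open>trace (A ** transpose B)\<close>.
\<close>

lemma inner_matrix_eq_trace:
  fixes A B :: "real ^ 'r ^ 'd"
  shows "A \<bullet> B = trace (A ** transpose B)"
  by (simp add: trace_def inner_vec_def matrix_matrix_mult_def transpose_def)

definition skew :: "real ^ 'n ^ 'n \<Rightarrow> real ^ 'n ^ 'n"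
  where "skew A = (1 / 2) *\<^sub>R (A - transpose A)"

definition symm :: "real ^ 'n ^ 'n \<Rightarrow> real ^ 'n ^ 'n"
  where "symm A = (1 / 2) *\<^sub>R (A + transpose A)"

definition stiefel :: "(real ^ 'r ^ 'd) set"
  where "stiefel = {x. transpose x ** x = mat 1}"

definition safety_region :: "real \<Rightarrow> (real ^ 'r ^ 'd) set"
  where "safety_region \<epsilon> = {x. norm (transpose x ** x - mat 1) \<le> \<epsilon>}"

definition nbhd :: "'a::metric_space set \<Rightarrow> real \<Rightarrow> 'a set"
  where "nbhd S \<delta> = {x. infdist x S \<le> \<delta>}"

text \<open>The Euclidean gradient; meaningful only where \<open>f\<close> is differentiable.\<close>

definition nabla :: "('a::euclidean_space \<Rightarrow> real) \<Rightarrow> 'a \<Rightarrow> 'a"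
  where "nabla f x = (THE D. GDERIV f x :> D)"

lemma nabla_eqI:
  assumes "GDERIV f x :> D"
  shows "nabla f x = D"
  unfolding nabla_def
proof (rule the_equality)
  show "GDERIV f x :> D" by fact
next
  fix E assume "GDERIV f x :> E"
  then have "(\<lambda>h. h \<bullet> E) = (\<lambda>h. h \<bullet> D)"
    using assms has_derivative_unique unfolding gderiv_def by blast
  then have "\<forall>h. h \<bullet> E = h \<bullet> D" by meson
  then show "E = D" by (simp only: vector_eq_ldot)
qed

lemma GDERIV_nabla:
  fixes f :: "'a::euclidean_space \<Rightarrow> real"
  assumes "f differentiable (at x)"
  shows "GDERIV f x :> nabla f x"
proof -
  obtain f' where f': "(f has_derivative f') (at x)"
    using assms unfolding differentiable_def by blast
  then have "linear f'" by (rule has_derivative_linear)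
  then have "f' h = h \<bullet> adjoint f' 1" for h
    using adjoint_works[of f' h 1] by simp
  then have "GDERIV f x :> adjoint f' 1"
    using f' unfolding gderiv_def by (metis (no_types, lifting) ext)
  then show ?thesis using nabla_eqI by metis
qed

definition twice_continuously_differentiable :: "('a::euclidean_space \<Rightarrow> real) \<Rightarrow> bool"
  where "twice_continuously_differentiable f \<longleftrightarrow>
    (\<forall>x. f differentiable (at x)) \<and>
    (\<exists>H :: 'a \<Rightarrow> 'a \<Rightarrow>\<^sub>L 'a.
      (\<forall>x. (nabla f has_derivative blinfun_apply (H x)) (at x)) \<and> continuous_on UNIV H)"

definition quadratic_upper_bound_on :: "real \<Rightarrow> 'a set \<Rightarrow> ('a::euclidean_space \<Rightarrow> real) \<Rightarrow> bool"
  where "quadratic_upper_bound_on L A g \<longleftrightarrow>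
    (\<forall>x\<in>A. \<forall>y\<in>A. g y \<le> g x + nabla g x \<bullet> (y - x) + L / 2 * (norm (y - x))\<^sup>2)"

text \<open>
  \<open>L\<close>-smoothness in the usual sense: the gradient is \<open>L\<close>-Lipschitz. For differentiable \<open>f\<close> the
  quadratic upper bound follows from it and is listed because it is the form usually displayed.
  The converse fails: the upper bound alone leaves negative curvature unbounded (every
  concave \<open>f\<close> satisfies it with \<open>L = 0\<close>), and the linear convergence of the landing algorithm
  is then false.
\<close>

definition smooth_fun :: "real \<Rightarrow> ('a::euclidean_space \<Rightarrow> real) \<Rightarrow> bool"
  where "smooth_fun L f \<longleftrightarrow>
    L-lipschitz_on UNIV (nabla f) \<and> quadratic_upper_bound_on L UNIV f"

definition rgrad :: "(real ^ 'r ^ 'd \<Rightarrow> real) \<Rightarrow> real ^ 'r ^ 'd \<Rightarrow> real ^ 'r ^ 'd"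
  where "rgrad f x = skew (nabla f x ** transpose x) ** x"

definition penalty :: "real ^ 'r ^ 'd \<Rightarrow> real"
  where "penalty x = 1 / 4 * (norm (transpose x ** x - mat 1))\<^sup>2"

lemma bilinear_matrix_mult: "bounded_bilinear ((**) :: real ^ 'n ^ 'm \<Rightarrow> real ^ 'k ^ 'n \<Rightarrow> real ^ 'k ^ 'm)"
  unfolding bilinear_conv_bounded_bilinear[symmetric] bilinear_def
  by (auto intro!: linearI
      simp: matrix_matrix_mult_def vec_eq_iff sum.distrib algebra_simps sum_distrib_left)

lemma bounded_linear_transpose: "bounded_linear (transpose :: real ^ 'n ^ 'm \<Rightarrow> real ^ 'm ^ 'n)"
  unfolding linear_conv_bounded_linear[symmetric]
  by (auto intro!: linearI simp: transpose_def vec_eq_iff)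

lemma inner_transpose:
  fixes A B :: "real ^ 'n ^ 'm"
  shows "transpose A \<bullet> transpose B = A \<bullet> B"
  unfolding inner_vec_def transpose_def by (simp add: sum.swap[of _ "UNIV :: 'm set"])

lemma inner_matrix_mult_left:
  fixes A :: "real ^ 'n ^ 'm" and B :: "real ^ 'k ^ 'n"
  shows "(A ** B) \<bullet> C = B \<bullet> (transpose A ** C)"
proof -
  have "(A ** B) \<bullet> C = (\<Sum>i\<in>UNIV. \<Sum>j\<in>UNIV. \<Sum>l\<in>UNIV. A $ i $ l * B $ l $ j * C $ i $ j)"
    by (simp add: inner_vec_def matrix_matrix_mult_def sum_distrib_right)
  also have "\<dots> = (\<Sum>i\<in>UNIV. \<Sum>l\<in>UNIV. \<Sum>j\<in>UNIV. A $ i $ l * B $ l $ j * C $ i $ j)"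
    by (intro sum.cong refl) (rule sum.swap)
  also have "\<dots> = (\<Sum>l\<in>UNIV. \<Sum>i\<in>UNIV. \<Sum>j\<in>UNIV. A $ i $ l * B $ l $ j * C $ i $ j)"
    by (rule sum.swap)
  also have "\<dots> = (\<Sum>l\<in>UNIV. \<Sum>j\<in>UNIV. \<Sum>i\<in>UNIV. A $ i $ l * B $ l $ j * C $ i $ j)"
    by (intro sum.cong refl) (rule sum.swap)
  also have "\<dots> = B \<bullet> (transpose A ** C)"
    by (simp add: inner_vec_def matrix_matrix_mult_def transpose_def sum_distrib_left mult_ac)
  finally show ?thesis .
qed

lemma nabla_penalty: "nabla penalty x = x ** (transpose x ** x - mat 1)"
proof (rule nabla_eqI)
  let ?S = "transpose x ** x - mat 1"
  have sym: "transpose ?S = ?S"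
    by (simp add: linear_diff[OF bounded_linear.linear[OF bounded_linear_transpose]] matrix_transpose_mul
        transpose_mat)
  have inner_eq: "1 / 4 * (?S \<bullet> (transpose x ** h + transpose h ** x)
      + (transpose x ** h + transpose h ** x) \<bullet> ?S) = h \<bullet> (x ** ?S)" for h
  proof -
    have "(transpose h ** x) \<bullet> ?S = (transpose x ** h) \<bullet> ?S"
      using inner_transpose[of "transpose h ** x" ?S] sym by (simp add: matrix_transpose_mul)
    moreover have "(transpose x ** h) \<bullet> ?S = h \<bullet> (x ** ?S)"
      using inner_matrix_mult_left[of "transpose x" h ?S] by simp
    ultimately show ?thesis by (simp add: inner_add_left inner_commute[of ?S])
  qed
  have pen: "penalty = (\<lambda>x. 1 / 4 * ((transpose x ** x - mat 1) \<bullet> (transpose x ** x - mat 1)))"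
    by (rule ext) (simp add: penalty_def power2_norm_eq_inner)
  have dS: "((\<lambda>x. transpose x ** x - mat 1) has_derivative
      (\<lambda>h. transpose x ** h + transpose h ** x)) (at x)"
    by (rule derivative_eq_intros
        bounded_bilinear.FDERIV[OF bilinear_matrix_mult]
        bounded_linear.has_derivative[OF bounded_linear_transpose] has_derivative_ident refl)+ simp
  have "(penalty has_derivative (\<lambda>h. 1 / 4 * (?S \<bullet> (transpose x ** h + transpose h ** x)
      + (transpose x ** h + transpose h ** x) \<bullet> ?S))) (at x)"
    unfolding pen by (rule has_derivative_mult_right[OF has_derivative_inner[OF dS dS]])
  then show "GDERIV penalty x :> x ** ?S"
    unfolding gderiv_def inner_eq .
qed

definition landing :: "(real ^ 'r ^ 'd \<Rightarrow> real) \<Rightarrow> real \<Rightarrow> real ^ 'r ^ 'd \<Rightarrow> real ^ 'r ^ 'd"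
  where "landing f lam x = rgrad f x + lam *\<^sub>R nabla penalty x"

definition merit :: "(real ^ 'r ^ 'd \<Rightarrow> real) \<Rightarrow> real \<Rightarrow> real ^ 'r ^ 'd \<Rightarrow> real"
  where "merit f \<gamma> x =
    f x - 1 / 2 * (symm (transpose x ** nabla f x) \<bullet> (transpose x ** x - mat 1)) + \<gamma> * penalty x"

definition local_minima :: "(real ^ 'r ^ 'd \<Rightarrow> real) \<Rightarrow> real \<Rightarrow> (real ^ 'r ^ 'd) set"
  where "local_minima f v =
    {x \<in> stiefel. f x = v \<and> (\<exists>e>0. \<forall>y\<in>stiefel. dist y x < e \<longrightarrow> f x \<le> f y)}"

definition local_PL :: "(real ^ 'r ^ 'd \<Rightarrow> real) \<Rightarrow> real \<Rightarrow> real \<Rightarrow> real \<Rightarrow> bool"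
  where "local_PL f v \<mu> \<delta> \<longleftrightarrow>
    (\<forall>x \<in> stiefel \<inter> nbhd (local_minima f v) (2 * \<delta>).
      \<bar>f x - v\<bar> \<le> 1 / (2 * \<mu>) * (norm (rgrad f x))\<^sup>2)"

definition s_const :: "(real ^ 'r ^ 'd \<Rightarrow> real) \<Rightarrow> real \<Rightarrow> real"
  where "s_const f \<epsilon> = (SUP x\<in>safety_region \<epsilon>. norm (symm (transpose x ** nabla f x)))"

definition L_hat :: "(real ^ 'r ^ 'd \<Rightarrow> real) \<Rightarrow> real \<Rightarrow> real \<Rightarrow> real"
  where "L_hat f L \<epsilon> = max L (SUP x\<in>safety_region \<epsilon>. norm (nabla f x))"

definition gamma_bound :: "(real ^ 'r ^ 'd \<Rightarrow> real) \<Rightarrow> real \<Rightarrow> real \<Rightarrow> real \<Rightarrow> real"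
  where "gamma_bound f L \<epsilon> lam = 2 / (3 - 4 * \<epsilon>) *
    (L * (1 - \<epsilon>) + 3 * s_const f \<epsilon> + (L_hat f L \<epsilon>)\<^sup>2 * ((1 + \<epsilon>)\<^sup>2 / (lam * (1 - \<epsilon>))))"

definition rho_const :: "real \<Rightarrow> real \<Rightarrow> real \<Rightarrow> real"
  where "rho_const \<gamma> \<epsilon> lam = min (1 / 2) (\<gamma> / (4 * lam * (1 + \<epsilon>)))"

definition mu_prime :: "real \<Rightarrow> real \<Rightarrow> real \<Rightarrow> real \<Rightarrow> real \<Rightarrow> real"
  where "mu_prime \<mu> Lhat L' \<epsilon> lam = 1 / max (1 / \<mu>)
    ((2 * (3 + 2 * \<epsilon>)\<^sup>2 * Lhat\<^sup>2 + \<mu> * L') / (2 * \<mu> * lam\<^sup>2 * (1 - \<epsilon>)\<^sup>2))"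

definition alpha_safe :: "real \<Rightarrow> real \<Rightarrow> real \<Rightarrow> real"
  where "alpha_safe G \<epsilon> lam =
    min (lam * \<epsilon> * (1 - \<epsilon>) / (G\<^sup>2 + lam\<^sup>2 * (1 + \<epsilon>) * \<epsilon>\<^sup>2))
      (min (sqrt (\<epsilon> / (2 * G\<^sup>2))) (1 / (2 * lam)))"

end

theory Submission
  imports Defs
begin

text \<open>
  Write \<open>D = gram_defect x\<close>. The landing field is the sum of the orthogonal vectors \<open>rgrad f x\<close> and
  \<open>lam *\<^sub>R (x ** D)\<close>, and for the given \<open>\<gamma>\<close> its inner product with the gradient of the merit function
  is at least \<open>\<rho>\<close> times its squared norm. So every step decreases the merit function by at least
  \<open>\<alpha> * \<rho> / 2\<close> times the squared norm of the landing field.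

  To turn this into a linear rate, compare \<open>x\<close> with its polar factor \<open>y\<close> on the Stiefel manifold: the
  merit function at \<open>x\<close> exceeds \<open>f y\<close> by at most a multiple of \<open>(norm D)\<^sup>2\<close>, and \<open>f y\<close> is controlled by the
  Riemannian gradient. The latter holds trivially when \<open>f y \<le> 0\<close>. When \<open>f y > 0\<close> one has to know that
  \<open>y\<close> lies within \<open>2 * \<delta>\<close> of the minima. Then the merit function at \<open>x\<close> dominates a multiple of
  \<open>(norm (x - y))\<^sup>2\<close>, so that the part of the length budget \<open>\<delta>\<close> that the iterates have not used yet pays for
  the distance from \<open>x\<close> to \<open>y\<close>. The merit function may become negative; it is nonincreasing, so the claimed
  bound is trivial from then on.
\<close>

section \<open>Matrix products and the Gram defect\<close>

lemmas matrix_mult_linear =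
  bounded_bilinear.add_left[OF bilinear_matrix_mult]
  bounded_bilinear.add_right[OF bilinear_matrix_mult]
  bounded_bilinear.diff_left[OF bilinear_matrix_mult]
  bounded_bilinear.diff_right[OF bilinear_matrix_mult]
  bounded_bilinear.minus_left[OF bilinear_matrix_mult]
  bounded_bilinear.minus_right[OF bilinear_matrix_mult]
  bounded_bilinear.scaleR_left[OF bilinear_matrix_mult]
  bounded_bilinear.scaleR_right[OF bilinear_matrix_mult]

lemmas transpose_linear =
  linear_add[OF bounded_linear.linear[OF bounded_linear_transpose]]
  linear_diff[OF bounded_linear.linear[OF bounded_linear_transpose]]
  linear_neg[OF bounded_linear.linear[OF bounded_linear_transpose]]
  linear_scale[OF bounded_linear.linear[OF bounded_linear_transpose]]

lemma norm_transpose: "norm (transpose A) = norm (A :: real ^ 'n ^ 'm)"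
  by (simp add: norm_eq_sqrt_inner inner_transpose)

lemma inner_matrix_mult_right:
  fixes A :: "real ^ 'n ^ 'm" and B :: "real ^ 'k ^ 'n"
  shows "(A ** B) \<bullet> C = A \<bullet> (C ** transpose B)"
proof -
  have "(A ** B) \<bullet> C = (transpose B ** transpose A) \<bullet> transpose C"
    using inner_transpose[of "A ** B" C] by (simp add: matrix_transpose_mul)
  also have "\<dots> = transpose A \<bullet> transpose (C ** transpose B)"
    by (simp add: inner_matrix_mult_left matrix_transpose_mul)
  finally show ?thesis by (simp only: inner_transpose)
qed

lemma norm_matrix_mult_le:
  fixes A :: "real ^ 'n ^ 'm" and B :: "real ^ 'k ^ 'n"
  shows "norm (A ** B) \<le> norm A * norm B"
proof -
  have "(norm (A ** B))\<^sup>2 = (\<Sum>i\<in>UNIV. \<Sum>j\<in>UNIV. ((A $ i) \<bullet> (transpose B $ j))\<^sup>2)"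
    unfolding power2_norm_eq_inner
    by (simp add: inner_vec_def matrix_matrix_mult_def transpose_def power2_eq_square)
  also have "\<dots> \<le> (\<Sum>i\<in>UNIV. \<Sum>j\<in>UNIV. (A $ i \<bullet> A $ i) * (transpose B $ j \<bullet> transpose B $ j))"
    by (intro sum_mono Cauchy_Schwarz_ineq)
  also have "\<dots> = (A \<bullet> A) * (transpose B \<bullet> transpose B)"
    by (simp only: inner_vec_def[of A A] inner_vec_def[of "transpose B" "transpose B"] sum_product)
  also have "\<dots> = (norm A * norm B)\<^sup>2"
    by (simp only: inner_transpose power_mult_distrib power2_norm_eq_inner)
  finally show ?thesis by (rule power2_le_imp_le) simp
qed

section \<open>Symmetric and skew-symmetric parts\<close>

lemma inner_skew_sym_zero:
  fixes A B :: "real ^ 'n ^ 'n"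
  assumes "transpose A = - A" "transpose B = B"
  shows "A \<bullet> B = 0"
  using inner_transpose[of A B] assms by simp

lemma transpose_skew: "transpose (skew A) = - skew A"
  by (simp add: skew_def transpose_linear scaleR_diff_right)

lemma transpose_symm: "transpose (symm A) = symm A"
  by (simp add: symm_def transpose_linear add.commute)

lemma symm_add_skew: "symm A + skew A = A"
  by (simp add: symm_def skew_def algebra_simps flip: scaleR_add_left)

lemma symm_inner_sym:
  assumes "transpose B = B"
  shows "symm A \<bullet> B = A \<bullet> B"
proof -
  have "(symm A + skew A) \<bullet> B = symm A \<bullet> B"
    using inner_skew_sym_zero[OF transpose_skew assms] by (simp add: inner_add_left)
  then show ?thesis by (simp add: symm_add_skew)
qed

lemma inner_skew: "A \<bullet> skew A = (norm (skew A))\<^sup>2"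
proof -
  have "(symm A + skew A) \<bullet> skew A = (norm (skew A))\<^sup>2"
    using inner_skew_sym_zero[OF transpose_skew transpose_symm, of A A]
    by (simp add: inner_add_left power2_norm_eq_inner inner_commute[of "symm A"])
  then show ?thesis by (simp add: symm_add_skew)
qed

text \<open>\<open>skew\<close> is the orthogonal projection onto the skew-symmetric
  matrices.\<close>

lemma norm_skew_le: "norm (skew A) \<le> norm A"
proof -
  have "(norm (skew A))\<^sup>2 \<le> norm A * norm (skew A)"
    using Cauchy_Schwarz_ineq2[of A "skew A"] inner_skew[of A] by simp
  then show ?thesis by (cases "skew A = 0") (auto simp: power2_eq_square)
qed

lemma skew_diff: "skew (A - B) = skew A - skew B"
  by (simp add: skew_def transpose_linear algebra_simps)

section \<open>The Gram matrix and norm bounds in the safety region\<close>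

definition gram_defect :: "real ^ 'r ^ 'd \<Rightarrow> real ^ 'r ^ 'r"
  where "gram_defect x = transpose x ** x - mat 1"

lemma gram_eq: "transpose x ** x = mat 1 + gram_defect x"
  by (simp add: gram_defect_def)

lemma transpose_gram_defect: "transpose (gram_defect x) = gram_defect x"
  by (simp add: gram_defect_def transpose_linear matrix_transpose_mul)

lemma safety_region_eq: "safety_region \<epsilon> = {x. norm (gram_defect x) \<le> \<epsilon>}"
  by (simp add: safety_region_def gram_defect_def)

lemma stiefel_eq: "stiefel = {x. gram_defect x = 0}"
  by (simp add: stiefel_def gram_defect_def)

lemma stiefel_subset_safety: "0 \<le> \<epsilon> \<Longrightarrow> stiefel \<subseteq> safety_region \<epsilon>"
  by (auto simp: stiefel_eq safety_region_eq)

lemma norm_mult_gram: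
  "(norm (x ** Y))\<^sup>2 = (norm Y)\<^sup>2 + (gram_defect x ** Y) \<bullet> Y"
proof -
  have "(norm (x ** Y))\<^sup>2 = (transpose x ** x ** Y) \<bullet> Y"
    by (simp add: power2_norm_eq_inner inner_matrix_mult_left matrix_mul_assoc inner_commute)
  then show ?thesis
    by (simp add: gram_eq matrix_mult_linear inner_add_left power2_norm_eq_inner)
qed

text \<open>By \<open>norm_mult_gram\<close> the two squared norms differ by a quadratic form whose
  matrix has norm at most \<epsilon>, so multiplication by \<open>x\<close> from the left is nearly
  isometric.\<close>

lemma norm_mult_bounds:
  assumes "x \<in> safety_region \<epsilon>"
  shows "(norm (x ** Y))\<^sup>2 \<le> (1 + \<epsilon>) * (norm Y)\<^sup>2" "(1 - \<epsilon>) * (norm Y)\<^sup>2 \<le> (norm (x ** Y))\<^sup>2"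
proof -
  have "\<bar>(gram_defect x ** Y) \<bullet> Y\<bar> \<le> norm (gram_defect x ** Y) * norm Y"
    by (rule Cauchy_Schwarz_ineq2)
  also have "\<dots> \<le> (norm (gram_defect x) * norm Y) * norm Y"
    by (intro mult_right_mono norm_matrix_mult_le) simp
  also have "\<dots> \<le> (\<epsilon> * norm Y) * norm Y"
    using assms by (intro mult_right_mono) (auto simp: safety_region_eq)
  finally have "\<bar>(gram_defect x ** Y) \<bullet> Y\<bar> \<le> \<epsilon> * (norm Y)\<^sup>2"
    by (simp add: power2_eq_square)
  then show "(norm (x ** Y))\<^sup>2 \<le> (1 + \<epsilon>) * (norm Y)\<^sup>2" "(1 - \<epsilon>) * (norm Y)\<^sup>2 \<le> (norm (x ** Y))\<^sup>2"
    by (auto simp: norm_mult_gram algebra_simps)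
qed

lemma norm_mult_transpose_le:
  assumes "x \<in> safety_region \<epsilon>"
  shows "(norm (B ** transpose x))\<^sup>2 \<le> (1 + \<epsilon>) * (norm B)\<^sup>2"
  using norm_mult_bounds(1)[OF assms, of "transpose B"] norm_transpose[of "x ** transpose B"]
  by (simp add: norm_transpose matrix_transpose_mul)

text \<open>Here the relevant product is \<open>x ** transpose x\<close>, not the Gram matrix.
  Pairing \<open>A ** x\<close> with itself and moving one \<open>x\<close> across reduces the claim
  to \<open>norm_mult_transpose_le\<close>, after which one factor
  \<open>(norm (A ** x))\<^sup>2\<close> cancels.\<close>

lemma norm_mult_right_le:
  assumes "x \<in> safety_region \<epsilon>" "0 \<le> \<epsilon>"
  shows "(norm (A ** x))\<^sup>2 \<le> (1 + \<epsilon>) * (norm A)\<^sup>2"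
proof -
  let ?n = "norm (A ** x)"
  have "?n\<^sup>2 = A \<bullet> (A ** x ** transpose x)"
    by (simp add: power2_norm_eq_inner inner_matrix_mult_right[of A x])
  also have "\<dots> \<le> norm A * norm (A ** x ** transpose x)"
    by (rule norm_cauchy_schwarz)
  finally have "(?n\<^sup>2)\<^sup>2 \<le> (norm A * norm (A ** x ** transpose x))\<^sup>2"
    by (rule power_mono) simp
  also have "\<dots> \<le> (norm A)\<^sup>2 * ((1 + \<epsilon>) * ?n\<^sup>2)"
    unfolding power_mult_distrib by (intro mult_left_mono norm_mult_transpose_le assms) simp
  finally have "?n\<^sup>2 * ?n\<^sup>2 \<le> ((1 + \<epsilon>) * (norm A)\<^sup>2) * ?n\<^sup>2"
    by (simp add: power2_eq_square mult_ac)
  then show ?thesis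
  proof (cases "?n = 0")
    case True
    then show ?thesis using assms by simp
  next
    case False
    then have "?n\<^sup>2 > 0" by simp
    then show ?thesis using \<open>?n\<^sup>2 * ?n\<^sup>2 \<le> _\<close> by (rule mult_right_le_imp_le[rotated])
  qed
qed

lemma transpose_conj_skew:
  fixes A :: "real ^ 'd ^ 'd" and x :: "real ^ 'r ^ 'd"
  assumes "transpose A = - A"
  shows "transpose (transpose x ** A ** x) = - (transpose x ** A ** x)"
  by (simp add: matrix_transpose_mul assms matrix_mult_linear matrix_mul_assoc)

text \<open>\<open>transpose x ** A ** x\<close> inherits skew symmetry. This makes the two
  components of the landing field orthogonal and, with \<open>M = mat 1\<close>, makes
  \<open>A ** x\<close> orthogonal to \<open>x\<close>.\<close>

lemma inner_skew_mult_sym: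
  fixes A :: "real ^ 'd ^ 'd" and x :: "real ^ 'r ^ 'd"
  assumes "transpose A = - A" "transpose M = M"
  shows "(A ** x) \<bullet> (x ** M) = 0"
proof -
  have "(A ** x) \<bullet> (x ** M) = (transpose x ** A ** x) \<bullet> M"
    by (metis inner_commute inner_matrix_mult_left matrix_mul_assoc)
  then show ?thesis using inner_skew_sym_zero[OF transpose_conj_skew[OF assms(1)] assms(2)] by simp
qed

section \<open>The landing step\<close>

lemma landing_eq:
  "landing f lam x = skew (nabla f x ** transpose x) ** x + lam *\<^sub>R (x ** gram_defect x)"
  by (simp add: landing_def rgrad_def nabla_penalty gram_defect_def)

lemma norm_landing:
  "(norm (landing f lam x))\<^sup>2 = (norm (rgrad f x))\<^sup>2 + lam\<^sup>2 * (norm (x ** gram_defect x))\<^sup>2"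
proof -
  have "rgrad f x \<bullet> (lam *\<^sub>R (x ** gram_defect x)) = 0"
    by (simp add: rgrad_def inner_skew_mult_sym[OF transpose_skew transpose_gram_defect])
  then show ?thesis
    by (simp add: landing_eq rgrad_def[symmetric] norm_add_Pythagorean orthogonal_def
        power_mult_distrib)
qed

text \<open>This is the derivative of the Gram defect along the landing field. The Riemannian
  gradient contributes a skew-symmetric term, which cancels against its transpose, so
  \<open>f\<close> affects the defect only to second order in the step size.\<close>

lemma landing_gram_derivative:
  "transpose x ** landing f lam x + transpose (landing f lam x) ** x
    = (2 * lam) *\<^sub>R (gram_defect x + gram_defect x ** gram_defect x)"
proof -
  let ?D = "gram_defect x" and ?A = "skew (nabla f x ** transpose x)"
  have 1: "transpose x ** landing f lam x = transpose x ** ?A ** x + lam *\<^sub>R (?D + ?D ** ?D)"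
    by (simp add: landing_eq matrix_mult_linear matrix_mul_assoc gram_eq)
  have "transpose (landing f lam x) ** x = transpose (transpose x ** landing f lam x)"
    by (simp add: matrix_transpose_mul)
  also have "\<dots> = - (transpose x ** ?A ** x) + lam *\<^sub>R (?D + ?D ** ?D)"
    unfolding 1 transpose_linear transpose_conj_skew[OF transpose_skew]
    by (simp add: transpose_linear matrix_transpose_mul transpose_gram_defect)
  finally show ?thesis unfolding 1 mult_2 scaleR_add_left by simp
qed

lemma gram_defect_step:
  "gram_defect (x - \<alpha> *\<^sub>R landing f lam x) =
    (1 - 2 * \<alpha> * lam) *\<^sub>R gram_defect x - (2 * \<alpha> * lam) *\<^sub>R (gram_defect x ** gram_defect x)
    + \<alpha>\<^sup>2 *\<^sub>R (transpose (landing f lam x) ** landing f lam x)"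
proof -
  let ?v = "landing f lam x"
  have "gram_defect (x - \<alpha> *\<^sub>R ?v) = gram_defect x - \<alpha> *\<^sub>R (transpose x ** ?v + transpose ?v ** x)
      + \<alpha>\<^sup>2 *\<^sub>R (transpose ?v ** ?v)"
    by (simp add: gram_defect_def transpose_linear matrix_mult_linear algebra_simps power2_eq_square)
  then show ?thesis
    unfolding landing_gram_derivative by (simp add: algebra_simps)
qed

text \<open>The terms linear in \<alpha> lower the bound \<epsilon> by
  \<open>2 * \<alpha> * lam * \<epsilon> * (1 - \<epsilon>)\<close>. The restrictions in
  \<open>alpha_safe\<close> keep the factor \<open>1 - 2 * \<alpha> * lam\<close> nonnegative and
  the term quadratic in \<alpha> within half of that decrease.\<close>

lemma safety_region_step:
  assumes x: "x \<in> safety_region \<epsilon>" and \<epsilon>: "0 < \<epsilon>" "\<epsilon> < 1" and lam: "lam > 0"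
    and G: "G > 0" "norm (rgrad f x) \<le> G"
    and \<alpha>: "0 < \<alpha>" "\<alpha> \<le> alpha_safe G \<epsilon> lam"
  shows "x - \<alpha> *\<^sub>R landing f lam x \<in> safety_region \<epsilon>"
proof -
  let ?D = "gram_defect x" and ?v = "landing f lam x"
  \<comment> \<open>\<open>K\<close> bounds the squared norm of the landing field on the safety
    region; it is the denominator in \<open>alpha_safe\<close>.\<close>
  define K where "K = G\<^sup>2 + lam\<^sup>2 * (1 + \<epsilon>) * \<epsilon>\<^sup>2"
  have K: "K > 0" using G \<epsilon> by (simp add: K_def add_pos_nonneg)
  have D: "norm ?D \<le> \<epsilon>" using x by (simp add: safety_region_eq)
  have a1: "2 * \<alpha> * lam \<le> 1"
    using \<alpha>(2) lam by (simp add: alpha_safe_def field_simps)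
  have a2: "\<alpha> * K \<le> lam * \<epsilon> * (1 - \<epsilon>)"
    using \<alpha>(2) K unfolding K_def[symmetric] alpha_safe_def by (simp add: field_simps K_def)
  have "(norm (x ** ?D))\<^sup>2 \<le> (1 + \<epsilon>) * \<epsilon>\<^sup>2"
    by (rule order_trans[OF norm_mult_bounds(1)[OF x]])
       (use D \<epsilon> in \<open>auto intro!: mult_left_mono power_mono\<close>)
  moreover have "(norm (rgrad f x))\<^sup>2 \<le> G\<^sup>2" using G by (intro power_mono) auto
  ultimately have v: "(norm ?v)\<^sup>2 \<le> K"
    unfolding norm_landing K_def by (auto intro!: add_mono mult_left_mono simp: mult.assoc)
  have vv: "norm (transpose ?v ** ?v) \<le> (norm ?v)\<^sup>2"
    using norm_matrix_mult_le[of "transpose ?v" ?v] by (simp add: norm_transpose power2_eq_square)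
  have DD: "norm (?D ** ?D) \<le> \<epsilon> * \<epsilon>"
    by (rule order_trans[OF norm_matrix_mult_le]) (use D \<epsilon> in \<open>auto intro!: mult_mono\<close>)
  have "norm (gram_defect (x - \<alpha> *\<^sub>R ?v)) \<le> norm ((1 - 2 * \<alpha> * lam) *\<^sub>R ?D)
      + norm ((2 * \<alpha> * lam) *\<^sub>R (?D ** ?D)) + norm (\<alpha>\<^sup>2 *\<^sub>R (transpose ?v ** ?v))"
    unfolding gram_defect_step by (meson add_right_mono norm_triangle_ineq norm_triangle_ineq4 order_trans)
  also have "\<dots> = (1 - 2 * \<alpha> * lam) * norm ?D + (2 * \<alpha> * lam) * norm (?D ** ?D)
      + \<alpha>\<^sup>2 * norm (transpose ?v ** ?v)"
    using a1 \<alpha> lam by simp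
  also have "\<dots> \<le> (1 - 2 * \<alpha> * lam) * \<epsilon> + (2 * \<alpha> * lam) * (\<epsilon> * \<epsilon>) + \<alpha>\<^sup>2 * K"
    using a1 \<alpha> lam D DD order_trans[OF vv v] by (intro add_mono mult_left_mono) auto
  also have "\<dots> = \<epsilon> - \<alpha> * (lam * \<epsilon> * (1 - \<epsilon>)) - \<alpha> * (lam * \<epsilon> * (1 - \<epsilon>) - \<alpha> * K)"
    by (simp add: algebra_simps power2_eq_square)
  also have "\<dots> \<le> \<epsilon> - \<alpha> * (lam * \<epsilon> * (1 - \<epsilon>))"
    using a2 \<alpha> by simp
  also have "\<dots> \<le> \<epsilon>" using \<alpha> lam \<epsilon> by simp
  finally show ?thesis by (simp add: safety_region_eq)
qed

section \<open>Polar decomposition\<close>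

lemma norm_matrix_vector_mult_le:
  fixes A :: "real ^ 'n ^ 'm"
  shows "norm (A *v v) \<le> norm A * norm v"
proof -
  have "(norm (A *v v))\<^sup>2 = (\<Sum>i\<in>UNIV. (A $ i \<bullet> v)\<^sup>2)"
    unfolding power2_norm_eq_inner
    by (simp add: inner_vec_def matrix_vector_mult_def power2_eq_square)
  also have "\<dots> \<le> (\<Sum>i\<in>UNIV. (A $ i \<bullet> A $ i) * (v \<bullet> v))"
    by (intro sum_mono Cauchy_Schwarz_ineq)
  also have "\<dots> = (A \<bullet> A) * (v \<bullet> v)"
    by (simp only: inner_vec_def[of A A] sum_distrib_right)
  also have "\<dots> = (norm A * norm v)\<^sup>2"
    by (simp only: power_mult_distrib power2_norm_eq_inner)
  finally show ?thesis by (rule power2_le_imp_le) simp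
qed

text \<open>
  The shifted square root \<open>M\<close> of \<open>mat 1 + D\<close> is the fixed point of \<open>M \<mapsto> (D - M\<^sup>2) / 2\<close>,
  a contraction of the ball of radius \<open>1 - sqrt (1 - \<epsilon>)\<close>, which it maps into itself.
\<close>

lemma matrix_sqrt_exists:
  fixes D :: "real ^ 'n ^ 'n"
  assumes sym: "transpose D = D" and D: "norm D \<le> \<epsilon>" and \<epsilon>: "0 \<le> \<epsilon>" "\<epsilon> < 3 / 4"
  obtains M where "transpose M = M" "norm M \<le> 1 - sqrt (1 - \<epsilon>)" "2 *\<^sub>R M + M ** M = D"
proof -
  define m where "m = 1 - sqrt (1 - \<epsilon>)"
  define B where "B = {M :: real ^ 'n ^ 'n. transpose M = M} \<inter> cball 0 m"
  define T where "T M = (1 / 2) *\<^sub>R (D - M ** M)" for M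
  have "sqrt (1 - \<epsilon>) \<ge> sqrt (1 / 4)" using \<epsilon> by (intro real_sqrt_le_mono) auto
  then have m: "m \<le> 1 / 2" by (simp add: m_def real_sqrt_divide)
  have m0: "0 \<le> m" using \<epsilon> by (simp add: m_def)
  \<comment> \<open>The radius \<open>m\<close> is the smaller root of this quadratic equation,
    which is what makes the ball invariant under \<open>T\<close>.\<close>
  have mm: "\<epsilon> + m * m = 2 * m"
    using \<epsilon> real_sqrt_pow2[of "1 - \<epsilon>"] by (simp add: m_def algebra_simps power2_eq_square)
  have "closed {M :: real ^ 'n ^ 'n. transpose M = M}"
    by (intro closed_Collect_eq linear_continuous_on bounded_linear_transpose continuous_on_id)
  then have "complete B" by (auto simp: B_def complete_eq_closed)
  moreover have "0 \<in> B" using m0 by (simp add: B_def transpose_def vec_eq_iff)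
  then have "B \<noteq> {}" by blast
  moreover have "T ` B \<subseteq> B"
  proof (rule image_subsetI)
    fix M assume "M \<in> B"
    then have M: "transpose M = M" "norm M \<le> m" by (auto simp: B_def)
    have "norm (T M) \<le> (1 / 2) * (norm D + norm (M ** M))"
      using norm_triangle_ineq4[of D "M ** M"] by (simp add: T_def)
    also have "\<dots> \<le> (1 / 2) * (\<epsilon> + m * m)"
      using D norm_matrix_mult_le[of M M] mult_mono[OF M(2) M(2)] m0 by simp
    finally show "T M \<in> B" using M sym
      by (simp add: B_def T_def mm transpose_linear matrix_transpose_mul)
  qed
  moreover have "dist (T M) (T N) \<le> 1 / 2 * dist M N" if "M \<in> B \<and> N \<in> B" for M N
  proof -
    have M: "norm M \<le> 1 / 2" and N: "norm N \<le> 1 / 2" using that m by (auto simp: B_def)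
    \<comment> \<open>The difference of squares is split without commuting \<open>M\<close> and
      \<open>N\<close>; both have norm at most \<open>1 / 2\<close>, which gives the contraction
      factor \<open>1 / 2\<close>.\<close>
    have "T M - T N = (1 / 2) *\<^sub>R (N ** (N - M) + (N - M) ** M)"
      by (simp add: T_def matrix_mult_linear algebra_simps)
    then have "dist (T M) (T N) = (1 / 2) * norm (N ** (N - M) + (N - M) ** M)"
      by (simp add: dist_norm)
    also have "\<dots> \<le> (1 / 2) * (norm (N ** (N - M)) + norm ((N - M) ** M))"
      using norm_triangle_ineq by simp
    also have "\<dots> \<le> (1 / 2) * (norm N * norm (N - M) + norm (N - M) * norm M)"
      using norm_matrix_mult_le[of N "N - M"] norm_matrix_mult_le[of "N - M" M] by simp
    also have "\<dots> \<le> (1 / 2) * ((1 / 2) * norm (N - M) + norm (N - M) * (1 / 2))"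
      using M N by (intro mult_left_mono add_mono mult_right_mono) auto
    also have "\<dots> = 1 / 2 * dist M N" by (simp add: dist_norm norm_minus_commute)
    finally show ?thesis .
  qed
  ultimately have "\<exists>!M. M \<in> B \<and> T M = M"
    using Banach_fix[of B "1 / 2" T] by auto
  then obtain M where M: "M \<in> B" "T M = M" by blast
  have "2 *\<^sub>R T M = D - M ** M" by (simp add: T_def)
  then have "2 *\<^sub>R M + M ** M = D" using M(2) by simp
  then show thesis using M(1) that by (auto simp: B_def m_def)
qed

text \<open>
  The polar decomposition \<open>x = y (mat 1 + M)\<close>. The matrix \<open>N\<close> is \<open>(mat 1 + M)\<^sup>-\<^sup>1 - mat 1\<close>, and
  \<open>- gram_defect x / 2\<close> is its first order approximation.
\<close>

lemma polar_decomposition: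
  fixes x :: "real ^ 'r ^ 'd"
  assumes x: "x \<in> safety_region \<epsilon>" and \<epsilon>: "0 \<le> \<epsilon>" "\<epsilon> < 3 / 4" and u: "u = sqrt (1 - \<epsilon>)"
  obtains y M N where "y \<in> stiefel" "transpose M = M" "x - y = y ** M" "transpose N = N"
    "y - x = x ** N" "(1 + u) * norm M \<le> norm (gram_defect x)"
    "norm (N + (1 / 2) *\<^sub>R gram_defect x) \<le> (1 / u + 1 / 2) * (norm M)\<^sup>2"
proof -
  let ?D = "gram_defect x"
  obtain M where M: "transpose M = M" "norm M \<le> 1 - u" "2 *\<^sub>R M + M ** M = ?D"
    using matrix_sqrt_exists[OF transpose_gram_defect _ \<epsilon>] x u unfolding safety_region_eq by blast
  have "sqrt (1 - \<epsilon>) \<ge> sqrt (1 / 4)" using \<epsilon> by (intro real_sqrt_le_mono) auto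
  then have u_half: "u \<ge> 1 / 2" by (simp add: u real_sqrt_divide)
  define P where "P = mat 1 + M"
  have tP: "transpose P = P" by (simp add: P_def transpose_linear M)
  have PP: "P ** P = transpose x ** x"
    by (simp add: gram_eq P_def matrix_mult_linear M(3)[symmetric] scaleR_2)
  \<comment> \<open>\<open>M\<close> has norm at most \<open>1 / 2\<close>, so \<open>P\<close> has
    trivial kernel and is invertible.\<close>
  have "\<forall>v. P *v v = 0 \<longrightarrow> v = 0"
  proof (intro allI impI)
    fix v assume "P *v v = 0"
    then have "v = - (M *v v)"
      by (simp add: P_def matrix_vector_mult_add_rdistrib eq_neg_iff_add_eq_0)
    then have "norm v \<le> norm M * norm v"
      using norm_matrix_vector_mult_le[of M v] by (metis norm_minus_cancel)
    also have "\<dots> \<le> 1 / 2 * norm v" using M(2) u_half by (intro mult_right_mono) auto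
    finally show "v = 0" by simp
  qed
  then obtain W where WP: "W ** P = mat 1" using matrix_left_invertible_ker[of P] by auto
  then have PW: "P ** W = mat 1" by (simp add: matrix_left_right_inverse)
  have "transpose W ** P = mat 1"
    using arg_cong[OF PW, of transpose] by (simp add: matrix_transpose_mul tP)
  then have tW: "transpose W = W"
    by (metis PW matrix_mul_assoc matrix_mul_lid matrix_mul_rid)
  define y where "y = x ** W"
  define N where "N = W - mat 1"
  define Y where "Y = M ** M ** W"
  have "transpose y ** y = W ** (transpose x ** x) ** W"
    by (simp add: y_def matrix_transpose_mul tW matrix_mul_assoc)
  also have "\<dots> = (W ** P) ** (P ** W)" by (simp add: PP[symmetric] matrix_mul_assoc)
  finally have "y \<in> stiefel" by (simp add: WP PW stiefel_def)
  moreover have "y ** P = x" by (simp add: y_def matrix_mul_assoc[symmetric] WP)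
  then have "x - y = y ** M" by (auto simp: P_def matrix_mult_linear)
  moreover have "transpose N = N" by (simp add: N_def transpose_linear tW)
  moreover have "y - x = x ** N" by (simp add: N_def y_def matrix_mult_linear)
  moreover have "(1 + u) * norm M \<le> norm ?D"
  proof -
    have "2 * norm M = norm (?D - M ** M)" using M(3)[symmetric] by simp
    also have "\<dots> \<le> norm ?D + norm M * norm M"
      by (rule order_trans[OF norm_triangle_ineq4]) (simp add: norm_matrix_mult_le)
    also have "\<dots> \<le> norm ?D + (1 - u) * norm M" using M(2) by (simp add: mult_right_mono)
    finally show ?thesis by (simp add: algebra_simps)
  qed
  \<comment> \<open>\<open>Y\<close> is the remainder of the Neumann series of \<open>W\<close>
    after the linear term, so \<open>N = Y - M\<close>. Half of the Gram defect is \<open>M\<close>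
    plus half of \<open>M ** M\<close>, hence the linear terms cancel. The identity
    \<open>Y = M ** M - Y ** M\<close> then bounds \<open>Y\<close>.\<close>
  moreover have "norm (N + (1 / 2) *\<^sub>R ?D) \<le> (1 / u + 1 / 2) * (norm M)\<^sup>2"
  proof -
    have MM: "norm (M ** M) \<le> (norm M)\<^sup>2"
      using norm_matrix_mult_le[of M M] by (simp add: power2_eq_square)
    have W1: "W = mat 1 - M ** W"
      using PW by (auto simp: P_def matrix_mult_linear algebra_simps)
    have "M ** W = M - Y"
      using arg_cong[OF W1, of "\<lambda>Z. M ** Z"] by (simp add: matrix_mult_linear matrix_mul_assoc Y_def)
    then have "N = Y - M" using W1 by (simp add: N_def)
    then have eq: "N + (1 / 2) *\<^sub>R ?D = Y + (1 / 2) *\<^sub>R (M ** M)"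
      by (simp add: M(3)[symmetric] scaleR_add_right)
    have "Y ** P = M ** M" by (simp add: Y_def matrix_mul_assoc[symmetric] WP)
    then have "Y = M ** M - Y ** M" by (simp add: P_def matrix_mult_linear eq_diff_eq)
    then have "norm Y \<le> (norm M)\<^sup>2 + norm Y * norm M"
      using norm_triangle_ineq4[of "M ** M" "Y ** M"] norm_matrix_mult_le[of Y M] MM by simp
    also have "\<dots> \<le> (norm M)\<^sup>2 + norm Y * (1 - u)" using M(2) by (simp add: mult_left_mono)
    finally have "norm Y \<le> 1 / u * (norm M)\<^sup>2" using u_half by (simp add: field_simps)
    then show ?thesis unfolding eq
      using norm_triangle_ineq[of Y "(1 / 2) *\<^sub>R (M ** M)"] MM by (simp add: algebra_simps)
  qed
  ultimately show thesis using M(1) that by blast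
qed

section \<open>Descent of the merit function\<close>

lemma nabla_inner:
  assumes "(F has_derivative D) (at x)"
  shows "nabla F x \<bullet> v = D v"
proof -
  have "GDERIV F x :> nabla F x" using assms by (intro GDERIV_nabla differentiableI)
  then have "D = (\<lambda>v. v \<bullet> nabla F x)"
    using assms has_derivative_unique unfolding gderiv_def by blast
  then show ?thesis by (simp add: inner_commute)
qed

lemma gram_defect_has_derivative:
  "(gram_defect has_derivative (\<lambda>v. transpose x ** v + transpose v ** x)) (at x)"
  unfolding gram_defect_def
  by (rule derivative_eq_intros
      bounded_bilinear.FDERIV[OF bilinear_matrix_mult]
      bounded_linear.has_derivative[OF bounded_linear_transpose] has_derivative_ident refl)+ simp

lemma inner_gram_derivative:
  "gram_defect x \<bullet> (transpose x ** v + transpose v ** x) = 2 * (v \<bullet> (x ** gram_defect x))"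
proof -
  have "(transpose v ** x) \<bullet> gram_defect x = (transpose x ** v) \<bullet> gram_defect x"
    using inner_transpose[of "transpose v ** x" "gram_defect x"]
    by (simp add: matrix_transpose_mul transpose_gram_defect)
  moreover have "(transpose x ** v) \<bullet> gram_defect x = v \<bullet> (x ** gram_defect x)"
    by (simp add: inner_matrix_mult_left)
  ultimately show ?thesis by (simp add: inner_add_right inner_commute[of "gram_defect x"])
qed

text \<open>Against a symmetric matrix only the symmetric part counts. This removes
  \<open>symm\<close> from the merit function before it is differentiated.\<close>

lemma symm_inner_eq:
  assumes "transpose B = B"
  shows "symm (transpose x ** g) \<bullet> B = g \<bullet> (x ** B)"
  by (simp add: symm_inner_sym[OF assms] inner_matrix_mult_left)

lemma merit_eq:
  "merit f \<gamma> x = f x - 1 / 2 * (nabla f x \<bullet> (x ** gram_defect x)) + \<gamma> / 4 * (norm (gram_defect x))\<^sup>2"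
  by (simp add: merit_def penalty_def gram_defect_def[symmetric]
      symm_inner_eq[OF transpose_gram_defect])

lemma nabla_merit_inner:
  assumes f: "f differentiable (at x)" and H: "(nabla f has_derivative H) (at x)"
  shows "nabla (merit f \<gamma>) x \<bullet> v = nabla f x \<bullet> v
    - 1 / 2 * (nabla f x \<bullet> (x ** (transpose x ** v + transpose v ** x) + v ** gram_defect x)
      + H v \<bullet> (x ** gram_defect x)) + \<gamma> * (v \<bullet> (x ** gram_defect x))"
proof -
  have df: "(f has_derivative (\<lambda>v. v \<bullet> nabla f x)) (at x)"
    using GDERIV_nabla[OF f] by (simp add: gderiv_def)
  have m: "merit f \<gamma> = (\<lambda>x. f x - 1 / 2 * (nabla f x \<bullet> (x ** gram_defect x))
      + \<gamma> / 4 * (gram_defect x \<bullet> gram_defect x))"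
    by (rule ext) (simp add: merit_eq power2_norm_eq_inner)
  note dD = gram_defect_has_derivative[of x]
  have "(merit f \<gamma> has_derivative (\<lambda>v. v \<bullet> nabla f x
      - 1 / 2 * (nabla f x \<bullet> (x ** (transpose x ** v + transpose v ** x) + v ** gram_defect x)
        + H v \<bullet> (x ** gram_defect x))
      + \<gamma> / 4 * (gram_defect x \<bullet> (transpose x ** v + transpose v ** x)
        + (transpose x ** v + transpose v ** x) \<bullet> gram_defect x))) (at x)"
    unfolding m
    by (intro has_derivative_add has_derivative_diff has_derivative_mult_right has_derivative_inner
        bounded_bilinear.FDERIV[OF bilinear_matrix_mult] df H dD has_derivative_ident)
  from nabla_inner[OF this, of v] show ?thesis
    by (simp add: inner_commute[of _ "gram_defect x"] inner_gram_derivative inner_commute[of v])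
qed

text \<open>The factor \<open>1 / 2\<close> in the merit function is chosen so that the term
  \<open>lam * (nabla f x \<bullet> (x ** D))\<close>, of first order in the defect and without a
  sign, cancels. The remaining cross terms all carry \<open>D ** D\<close> or a product of
  \<open>D\<close> with the landing field or its tangential part.\<close>

lemma nabla_merit_inner_landing:
  fixes x :: "real ^ 'r ^ 'd"
  assumes f: "f differentiable (at x)" and H: "(nabla f has_derivative H) (at x)"
  defines "A \<equiv> skew (nabla f x ** transpose x)" and "D \<equiv> gram_defect x"
  shows "nabla (merit f \<gamma>) x \<bullet> landing f lam x = (norm A)\<^sup>2
    - 3 / 2 * lam * (symm (transpose x ** nabla f x) \<bullet> (D ** D))
    - 1 / 2 * (nabla f x \<bullet> (A ** x ** D)) - 1 / 2 * (H (landing f lam x) \<bullet> (x ** D))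
    + \<gamma> * lam * (norm (x ** D))\<^sup>2"
proof -
  let ?g = "nabla f x" and ?v = "landing f lam x"
  have v: "?v = A ** x + lam *\<^sub>R (x ** D)" by (simp add: landing_eq A_def D_def)
  have "(A ** x) \<bullet> (x ** D) = 0"
    unfolding A_def D_def by (rule inner_skew_mult_sym[OF transpose_skew transpose_gram_defect])
  then have vxD: "?v \<bullet> (x ** D) = lam * (norm (x ** D))\<^sup>2"
    by (simp add: v inner_add_left power2_norm_eq_inner)
  have "?g \<bullet> (A ** x) = (norm A)\<^sup>2"
    unfolding A_def using inner_skew[of "?g ** transpose x"]
    by (metis inner_commute inner_matrix_mult_right)
  then have gv: "?g \<bullet> ?v = (norm A)\<^sup>2 + lam * (?g \<bullet> (x ** D))"
    by (simp add: v inner_add_right)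
  have DD: "?g \<bullet> (x ** (D ** D)) = symm (transpose x ** ?g) \<bullet> (D ** D)"
    by (rule symm_inner_eq[symmetric]) (simp add: D_def matrix_transpose_mul transpose_gram_defect)
  have "?g \<bullet> (x ** ((2 * lam) *\<^sub>R (D + D ** D)) + ?v ** D)
      = 2 * lam * (?g \<bullet> (x ** D)) + 3 * lam * (?g \<bullet> (x ** (D ** D))) + ?g \<bullet> (A ** x ** D)"
    by (simp add: v matrix_mult_linear inner_add_right matrix_mul_assoc algebra_simps)
  then show ?thesis
    unfolding nabla_merit_inner[OF f H] landing_gram_derivative D_def[symmetric] gv vxD
    by (simp add: DD algebra_simps)
qed

text \<open>Compactness turns the suprema in \<open>s_const\<close> and \<open>L_hat\<close> into
  genuine upper bounds. Boundedness is \<open>norm_mult_bounds\<close> for the identity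
  matrix.\<close>

lemma compact_safety_region: "compact (safety_region \<epsilon> :: (real ^ 'r ^ 'd) set)"
proof -
  have "continuous_on UNIV (gram_defect :: real ^ 'r ^ 'd \<Rightarrow> _)"
    using gram_defect_has_derivative has_derivative_continuous continuous_at_imp_continuous_on by blast
  then have "closed (safety_region \<epsilon> :: (real ^ 'r ^ 'd) set)"
    unfolding safety_region_eq by (intro closed_Collect_le continuous_intros)
  moreover have "bounded (safety_region \<epsilon> :: (real ^ 'r ^ 'd) set)"
  proof (rule boundedI)
    fix x :: "real ^ 'r ^ 'd" assume "x \<in> safety_region \<epsilon>"
    then have "(norm x)\<^sup>2 \<le> (1 + \<epsilon>) * (norm (mat 1 :: real ^ 'r ^ 'r))\<^sup>2"
      using norm_mult_bounds(1)[of x \<epsilon> "mat 1"] by simp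
    then show "norm x \<le> sqrt ((1 + \<epsilon>) * (norm (mat 1 :: real ^ 'r ^ 'r))\<^sup>2)"
      by (rule real_le_rsqrt)
  qed
  ultimately show ?thesis by (simp add: compact_eq_bounded_closed)
qed

lemma norm_le_SUP_compact:
  fixes F :: "'a::metric_space \<Rightarrow> 'b::real_normed_vector"
  assumes "compact K" "continuous_on K F" "z \<in> K"
  shows "norm (F z) \<le> (SUP x\<in>K. norm (F x))"
proof (rule cSUP_upper[OF assms(3)])
  have "compact ((\<lambda>x. norm (F x)) ` K)"
    by (intro compact_continuous_image continuous_intros assms)
  then show "bdd_above ((\<lambda>x. norm (F x)) ` K)"
    by (intro bounded_imp_bdd_above compact_imp_bounded)
qed

lemma norm_nabla_le_L_hat:
  assumes "continuous_on UNIV (nabla f)" "x \<in> safety_region \<epsilon>"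
  shows "norm (nabla f x) \<le> L_hat f L \<epsilon>"
  using norm_le_SUP_compact[OF compact_safety_region continuous_on_subset[OF assms(1)] assms(2)]
  by (simp add: L_hat_def)

lemma norm_symm_le_s_const:
  assumes "continuous_on UNIV (nabla f)" "x \<in> safety_region \<epsilon>"
  shows "norm (symm (transpose x ** nabla f x)) \<le> s_const f \<epsilon>"
  unfolding s_const_def symm_def
  by (rule norm_le_SUP_compact[OF compact_safety_region _ assms(2)])
     (intro continuous_intros bounded_bilinear.continuous_on[OF bilinear_matrix_mult]
       bounded_linear.continuous_on[OF bounded_linear_transpose] continuous_on_subset[OF assms(1)],
       auto)

text \<open>Difference quotients along short multiples of \<open>v\<close> transfer the Lipschitz
  bound to the derivative. Applied to \<open>nabla f\<close>, this bounds the Hessian term in the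
  gradient of the merit function.\<close>

lemma has_derivative_norm_le_lipschitz:
  fixes g :: "'a::real_normed_vector \<Rightarrow> 'b::real_normed_vector"
  assumes g: "(g has_derivative H) (at x)" and L: "L-lipschitz_on UNIV g"
  shows "norm (H v) \<le> L * norm v"
proof (cases "v = 0")
  case True
  then show ?thesis using has_derivative_linear[OF g] by (simp add: linear_0)
next
  case False
  have lin: "linear H" using has_derivative_linear[OF g] .
  show ?thesis
  proof (rule field_le_epsilon)
    fix e :: real assume "e > 0"
    then have e: "e / norm v > 0" using False by simp
    then obtain d where d: "d > 0"
      "\<And>y. norm (y - x) < d \<Longrightarrow> norm (g y - g x - H (y - x)) \<le> e / norm v * norm (y - x)"
      using g unfolding has_derivative_at_alt by metis
    define t where "t = d / (2 * norm v)"
    have t: "t > 0" "norm (t *\<^sub>R v) < d" using d(1) False by (auto simp: t_def)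
    have "norm (H (t *\<^sub>R v)) \<le> norm (g (x + t *\<^sub>R v) - g x) + norm (g (x + t *\<^sub>R v) - g x - H (t *\<^sub>R v))"
      using norm_triangle_sub[of "H (t *\<^sub>R v)" "g (x + t *\<^sub>R v) - g x"]
      by (simp add: norm_minus_commute)
    also have "\<dots> \<le> L * norm (t *\<^sub>R v) + e / norm v * norm (t *\<^sub>R v)"
      using d(2)[of "x + t *\<^sub>R v"] t lipschitz_onD[OF L, of "x + t *\<^sub>R v" x]
      by (intro add_mono) (auto simp: dist_norm)
    finally have "t * norm (H v) \<le> t * (L * norm v + e)"
      using t(1) False by (simp add: linear_scale[OF lin] algebra_simps)
    then show "norm (H v) \<le> L * norm v + e" using t(1) by simp
  qed
qed

text \<open>
  In the next lemma \<open>a\<close>, \<open>b\<close>, \<open>d\<close> and \<open>q\<close> are the norms of \<open>rgrad f x\<close>, \<open>skew (nabla f x ** transpose x)\<close>,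
  \<open>gram_defect x\<close> and \<open>x ** gram_defect x\<close>.
\<close>

lemma descent_scalar_inequality:
  fixes a b d q \<epsilon> lam L K s \<gamma> :: real
  assumes \<epsilon>: "0 < \<epsilon>" "\<epsilon> < 3 / 4" and lam: "lam > 0" and nn: "0 \<le> a" "0 \<le> d" "0 \<le> q" "0 \<le> s"
    and L: "0 \<le> L" "L \<le> K"
    and ab: "a\<^sup>2 \<le> (1 + \<epsilon>) * b\<^sup>2" and dq: "(1 - \<epsilon>) * d\<^sup>2 \<le> q\<^sup>2"
    and \<gamma>: "\<gamma> \<ge> 2 / (3 - 4 * \<epsilon>) * (L * (1 - \<epsilon>) + 3 * s + K\<^sup>2 * ((1 + \<epsilon>)\<^sup>2 / (lam * (1 - \<epsilon>))))"
  shows "rho_const \<gamma> \<epsilon> lam * (a\<^sup>2 + lam\<^sup>2 * q\<^sup>2)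
    \<le> b\<^sup>2 - 3 / 2 * lam * (s * d\<^sup>2) - 1 / 2 * (K * (a * d)) - 1 / 2 * (L * (a + lam * q) * q)
      + \<gamma> * lam * q\<^sup>2"
proof -
  define w p where "w = 1 - \<epsilon>" and "p = 1 + \<epsilon>"
  have wp: "w > 0" "p > 0" "w + p = 2" using \<epsilon> by (auto simp: w_def p_def)
  define E where "E = L * w + 3 * s + K\<^sup>2 * (p\<^sup>2 / (lam * w))"
  have E: "E \<ge> 0" unfolding E_def using L nn wp lam by simp
  \<comment> \<open>The share \<open>1 / (4 * p)\<close> of \<gamma> is reserved for the left-hand
    side, where \<open>rho_const\<close> is at most \<open>\<gamma> / (4 * lam * p)\<close>; the
    rest has to absorb the error terms. After clearing denominators the claim is
    \<open>- \<epsilon> \<le> \<epsilon>\<close>.\<close>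
  have "1 / (2 * w) \<le> (1 - 1 / (4 * p)) * (2 / (3 - 4 * \<epsilon>))"
    using \<epsilon> wp by (simp add: divide_simps w_def p_def) (simp add: algebra_simps)
  then have "1 / (2 * w) * E \<le> (1 - 1 / (4 * p)) * (2 / (3 - 4 * \<epsilon>)) * E"
    by (rule mult_right_mono[OF _ E])
  also have "\<dots> \<le> (1 - 1 / (4 * p)) * \<gamma>"
    unfolding mult.assoc using \<gamma> \<epsilon> wp
    by (intro mult_left_mono) (auto simp: E_def w_def p_def field_simps)
  finally have "1 / (2 * w) * E * (lam * q\<^sup>2) \<le> (1 - 1 / (4 * p)) * \<gamma> * (lam * q\<^sup>2)"
    by (rule mult_right_mono) (use lam in simp)
  moreover have "1 / (2 * w) * E * (lam * q\<^sup>2)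
      = 1 / 2 * (lam * L * q\<^sup>2) + 3 / 2 * lam * (s * (q\<^sup>2 / w)) + 1 / 2 * ((p / w)\<^sup>2 * (K * q)\<^sup>2)"
    using wp lam by (simp add: E_def field_simps power2_eq_square)
  moreover have "3 / 2 * lam * (s * d\<^sup>2) \<le> 3 / 2 * lam * (s * (q\<^sup>2 / w))"
    using dq wp nn lam by (intro mult_left_mono) (auto simp: w_def field_simps)
  ultimately have gam: "1 / 2 * (lam * L * q\<^sup>2) + 3 / 2 * lam * (s * d\<^sup>2) + 1 / 2 * ((p / w)\<^sup>2 * (K * q)\<^sup>2)
      \<le> (1 - 1 / (4 * p)) * \<gamma> * (lam * q\<^sup>2)"
    by linarith
  have "(q + d)\<^sup>2 \<le> 2 * q\<^sup>2 + 2 * d\<^sup>2"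
    using zero_le_power2[of "q - d"] by (simp add: power2_eq_square algebra_simps)
  also have "\<dots> \<le> 2 * q\<^sup>2 + 2 * (q\<^sup>2 / w)"
    using dq wp by (simp add: w_def field_simps)
  also have "\<dots> \<le> 4 * (p / w) * q\<^sup>2"
  proof -
    have "2 + 2 / w \<le> 4 * (p / w)" using wp \<epsilon> by (simp add: field_simps w_def p_def)
    from mult_right_mono[OF this, of "q\<^sup>2"] show ?thesis by (simp add: algebra_simps)
  qed
  finally have qd: "(q + d)\<^sup>2 \<le> 4 * (p / w) * q\<^sup>2" .
  \<comment> \<open>Young's inequality with weight \<open>w / p\<close>. Since
    \<open>w + p = 2\<close>, this weight together with the \<open>a\<^sup>2\<close> of the
    left-hand side sums to \<open>2 / p * a\<^sup>2\<close>, which \<open>ab\<close> bounds by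
    \<open>2 * b\<^sup>2\<close>.\<close>
  have "0 \<le> (2 * (w / p) * a - K * (q + d))\<^sup>2 / (4 * (w / p))" using wp by simp
  also have "\<dots> = w / p * a\<^sup>2 - K * a * (q + d) + (p / w) * K\<^sup>2 * (q + d)\<^sup>2 / 4"
    using wp by (simp add: field_simps power2_eq_square)
  also have "(p / w) * K\<^sup>2 * (q + d)\<^sup>2 \<le> (p / w) * K\<^sup>2 * (4 * (p / w) * q\<^sup>2)"
    using wp by (intro mult_left_mono[OF qd]) auto
  finally have young: "K * a * (q + d) \<le> w / p * a\<^sup>2 + (p / w)\<^sup>2 * (K * q)\<^sup>2"
    by (simp add: power_mult_distrib power2_eq_square mult_ac)
  have "L * (a * q) \<le> K * (a * q)" using L nn by (intro mult_right_mono) auto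
  moreover have "w / p * a\<^sup>2 \<le> 2 * b\<^sup>2 - a\<^sup>2"
  proof -
    have "a\<^sup>2 * (w + p) \<le> 2 * (p * b\<^sup>2)" using ab unfolding wp(3) by (simp add: p_def)
    then show ?thesis using wp(2) by (simp add: field_simps)
  qed
  ultimately have main: "L * (a * q) + K * (a * d) \<le> 2 * b\<^sup>2 - a\<^sup>2 + (p / w)\<^sup>2 * (K * q)\<^sup>2"
    using young by (simp add: algebra_simps)
  have r: "rho_const \<gamma> \<epsilon> lam \<le> 1 / 2" "rho_const \<gamma> \<epsilon> lam \<le> \<gamma> / (4 * lam * p)"
    by (auto simp: rho_const_def p_def)
  have "rho_const \<gamma> \<epsilon> lam * a\<^sup>2 \<le> 1 / 2 * a\<^sup>2" by (rule mult_right_mono[OF r(1)]) simp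
  moreover have "rho_const \<gamma> \<epsilon> lam * (lam\<^sup>2 * q\<^sup>2) \<le> 1 / (4 * p) * \<gamma> * (lam * q\<^sup>2)"
    using mult_right_mono[OF r(2), of "lam\<^sup>2 * q\<^sup>2"] lam wp by (simp add: field_simps power2_eq_square)
  ultimately show ?thesis using gam main by (simp add: algebra_simps power2_eq_square)
qed

text \<open>Cauchy-Schwarz bounds the three cross terms of \<open>nabla_merit_inner_landing\<close>,
  which leaves an inequality between norms.\<close>

lemma landing_descent_direction:
  fixes x :: "real ^ 'r ^ 'd"
  assumes x: "x \<in> safety_region \<epsilon>" and \<epsilon>: "0 < \<epsilon>" "\<epsilon> < 3 / 4" and lam: "lam > 0"
    and f: "f differentiable (at x)" and H: "(nabla f has_derivative H) (at x)"
    and L: "L-lipschitz_on UNIV (nabla f)" and K: "L \<le> K" "norm (nabla f x) \<le> K"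
    and s: "norm (symm (transpose x ** nabla f x)) \<le> s"
    and \<gamma>: "\<gamma> \<ge> 2 / (3 - 4 * \<epsilon>) * (L * (1 - \<epsilon>) + 3 * s + K\<^sup>2 * ((1 + \<epsilon>)\<^sup>2 / (lam * (1 - \<epsilon>))))"
  shows "rho_const \<gamma> \<epsilon> lam * (norm (landing f lam x))\<^sup>2 \<le> nabla (merit f \<gamma>) x \<bullet> landing f lam x"
proof -
  define A D where "A = skew (nabla f x ** transpose x)" and "D = gram_defect x"
  have L0: "0 \<le> L" using L by (rule lipschitz_on_nonneg)
  have s0: "0 \<le> s" using s norm_ge_zero order_trans by blast
  have rg: "rgrad f x = A ** x" by (simp add: rgrad_def A_def)
  have v: "landing f lam x = A ** x + lam *\<^sub>R (x ** D)" by (simp add: landing_eq A_def D_def)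
  have t1: "symm (transpose x ** nabla f x) \<bullet> (D ** D) \<le> s * (norm D)\<^sup>2"
  proof -
    have "symm (transpose x ** nabla f x) \<bullet> (D ** D) \<le> norm (symm (transpose x ** nabla f x)) * norm (D ** D)"
      by (rule norm_cauchy_schwarz)
    also have "\<dots> \<le> s * (norm D * norm D)"
      using s s0 by (intro mult_mono norm_matrix_mult_le) auto
    finally show ?thesis by (simp add: power2_eq_square)
  qed
  have t2: "nabla f x \<bullet> (A ** x ** D) \<le> K * (norm (A ** x) * norm D)"
  proof -
    have "nabla f x \<bullet> (A ** x ** D) \<le> norm (nabla f x) * norm (A ** x ** D)"
      by (rule norm_cauchy_schwarz)
    also have "\<dots> \<le> K * (norm (A ** x) * norm D)"
      using K L0 by (intro mult_mono norm_matrix_mult_le) auto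
    finally show ?thesis .
  qed
  have t3: "H (landing f lam x) \<bullet> (x ** D) \<le> L * (norm (A ** x) + lam * norm (x ** D)) * norm (x ** D)"
  proof -
    have "norm (H (landing f lam x)) \<le> L * norm (landing f lam x)"
      by (rule has_derivative_norm_le_lipschitz[OF H L])
    also have "\<dots> \<le> L * (norm (A ** x) + lam * norm (x ** D))"
      unfolding v using L0 lam by (intro mult_left_mono order_trans[OF norm_triangle_ineq]) auto
    finally show ?thesis
      using norm_cauchy_schwarz[of "H (landing f lam x)" "x ** D"]
      by (meson mult_right_mono norm_ge_zero order_trans)
  qed
  have "rho_const \<gamma> \<epsilon> lam * ((norm (A ** x))\<^sup>2 + lam\<^sup>2 * (norm (x ** D))\<^sup>2)
    \<le> (norm A)\<^sup>2 - 3 / 2 * lam * (s * (norm D)\<^sup>2) - 1 / 2 * (K * (norm (A ** x) * norm D))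
      - 1 / 2 * (L * (norm (A ** x) + lam * norm (x ** D)) * norm (x ** D)) + \<gamma> * lam * (norm (x ** D))\<^sup>2"
    using \<epsilon> lam s0 L0 K(1) \<gamma> norm_mult_right_le[OF x] norm_mult_bounds(2)[OF x]
    by (intro descent_scalar_inequality) auto
  also have "\<dots> \<le> nabla (merit f \<gamma>) x \<bullet> landing f lam x"
    unfolding nabla_merit_inner_landing[OF f H, folded A_def D_def]
    using mult_left_mono[OF t1, of "3 / 2 * lam"] t2 t3 lam by linarith
  finally show ?thesis by (simp add: norm_landing rg D_def)
qed

section \<open>Comparison with the polar factor\<close>

lemma norm_stiefel_mult:
  assumes "y \<in> stiefel"
  shows "norm (y ** M) = norm M"
proof -
  have "(norm (y ** M))\<^sup>2 = (norm M)\<^sup>2"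
    using assms by (simp add: norm_mult_gram stiefel_eq)
  then show ?thesis by simp
qed

lemma norm_mult_stiefel_le:
  assumes "y \<in> stiefel"
  shows "norm (B ** y) \<le> norm B" "norm (C ** transpose y) \<le> norm C"
proof -
  have y: "y \<in> safety_region 0" using assms stiefel_subset_safety by blast
  show "norm (B ** y) \<le> norm B"
    by (rule power2_le_imp_le) (use norm_mult_right_le[OF y] in auto)
  show "norm (C ** transpose y) \<le> norm C"
    by (rule power2_le_imp_le) (use norm_mult_transpose_le[OF y] in auto)
qed

text \<open>The expression \<open>skew (nabla f x ** transpose x) ** x\<close> is changed into its
  value at \<open>y\<close> one factor at a time. The right factor costs
  \<open>(1 + \<epsilon>) * K\<close>, the transposed factor and the gradient cost \<open>K\<close>
  each.\<close>

lemma rgrad_stiefel_le: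
  fixes x y :: "real ^ 'r ^ 'd"
  assumes x: "x \<in> safety_region \<epsilon>" and y: "y \<in> stiefel" and \<epsilon>: "0 \<le> \<epsilon>"
    and L: "L-lipschitz_on UNIV (nabla f)" and K: "L \<le> K" "norm (nabla f x) \<le> K"
  shows "norm (rgrad f y) \<le> norm (rgrad f x) + (3 + 2 * \<epsilon>) * K * norm (x - y)"
proof -
  let ?g = "nabla f x" and ?h = "nabla f y" and ?n = "norm (x - y)"
  have K0: "0 \<le> K" using K(2) norm_ge_zero order_trans by blast
  have eq: "rgrad f y = rgrad f x - (skew (?g ** transpose x) ** (x - y)
      + (skew (?g ** transpose (x - y)) + skew ((?g - ?h) ** transpose y)) ** y)"
    by (simp add: rgrad_def skew_diff transpose_linear matrix_mult_linear algebra_simps)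
  have "norm (skew (?g ** transpose x) ** (x - y)) \<le> norm (?g ** transpose x) * ?n"
    by (rule order_trans[OF norm_matrix_mult_le mult_right_mono[OF norm_skew_le norm_ge_zero]])
  also have "norm (?g ** transpose x) \<le> (1 + \<epsilon>) * norm ?g"
  proof (rule power2_le_imp_le)
    have "(1 + \<epsilon>) * (norm ?g)\<^sup>2 \<le> (1 + \<epsilon>)\<^sup>2 * (norm ?g)\<^sup>2"
      using \<epsilon> by (intro mult_right_mono) (auto simp: power2_eq_square algebra_simps)
    then show "(norm (?g ** transpose x))\<^sup>2 \<le> ((1 + \<epsilon>) * norm ?g)\<^sup>2"
      using norm_mult_transpose_le[OF x, of ?g] by (simp add: power_mult_distrib)
  qed (use \<epsilon> in simp)
  also have "(1 + \<epsilon>) * norm ?g \<le> (1 + \<epsilon>) * K" using K \<epsilon> by simp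
  finally have t1: "norm (skew (?g ** transpose x) ** (x - y)) \<le> (1 + \<epsilon>) * K * ?n"
    by (simp add: mult_right_mono)
  have "norm (skew (?g ** transpose (x - y))) \<le> norm ?g * ?n"
    using order_trans[OF norm_skew_le norm_matrix_mult_le[of ?g "transpose (x - y)"]]
    unfolding norm_transpose .
  also have "\<dots> \<le> K * ?n" using K by (simp add: mult_right_mono)
  finally have t2: "norm (skew (?g ** transpose (x - y))) \<le> K * ?n" .
  have "norm (skew ((?g - ?h) ** transpose y)) \<le> norm (?g - ?h)"
    by (rule order_trans[OF norm_skew_le norm_mult_stiefel_le(2)[OF y]])
  also have "\<dots> \<le> L * ?n" using lipschitz_onD[OF L, of x y] by (simp add: dist_norm)
  also have "\<dots> \<le> K * ?n" using K by (simp add: mult_right_mono)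
  finally have t3: "norm (skew ((?g - ?h) ** transpose y)) \<le> K * ?n" .
  have "norm ((skew (?g ** transpose (x - y)) + skew ((?g - ?h) ** transpose y)) ** y)
      \<le> norm (skew (?g ** transpose (x - y)) + skew ((?g - ?h) ** transpose y))"
    by (rule norm_mult_stiefel_le(1)[OF y])
  also have "\<dots> \<le> K * ?n + K * ?n"
    by (rule order_trans[OF norm_triangle_ineq add_mono[OF t2 t3]])
  finally have t4: "norm ((skew (?g ** transpose (x - y)) + skew ((?g - ?h) ** transpose y)) ** y)
      \<le> 2 * K * ?n" by simp
  have "norm (rgrad f y) \<le> norm (rgrad f x) + ((1 + \<epsilon>) * K * ?n + 2 * K * ?n)"
    unfolding eq by (rule order_trans[OF norm_triangle_ineq4])
      (intro add_left_mono order_trans[OF norm_triangle_ineq] add_mono t1 t4)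
  also have "\<dots> \<le> norm (rgrad f x) + (3 + 2 * \<epsilon>) * K * ?n"
    using mult_nonneg_nonneg[OF mult_nonneg_nonneg[OF \<epsilon> K0], of ?n] by (simp add: algebra_simps)
  finally show ?thesis .
qed

lemma merit_stiefel: "y \<in> stiefel \<Longrightarrow> merit f \<gamma> y = f y"
  by (simp add: merit_eq stiefel_eq)

text \<open>
  The displacement \<open>x - y = y ** M\<close> is normal to the Stiefel manifold, and \<open>nabla (merit f \<gamma>) y\<close> is
  tangent to it, so the first order term of the quadratic upper bound vanishes.
\<close>

lemma merit_le_stiefel_value:
  fixes x y :: "real ^ 'r ^ 'd"
  assumes ub: "quadratic_upper_bound_on C (safety_region \<epsilon>) (merit f \<gamma>)"
    and x: "x \<in> safety_region \<epsilon>" and y: "y \<in> stiefel" and \<epsilon>: "0 \<le> \<epsilon>"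
    and M: "x - y = y ** M" "transpose M = M"
    and f: "f differentiable (at y)" and H: "(nabla f has_derivative H) (at y)"
  shows "merit f \<gamma> x \<le> f y + C / 2 * (norm M)\<^sup>2"
proof -
  have yy: "transpose y ** y = mat 1" and D: "gram_defect y = 0"
    using y by (simp add: stiefel_def, simp add: stiefel_eq)
  have eq: "transpose y ** (y ** M) + transpose (y ** M) ** y = 2 *\<^sub>R M"
    by (simp add: matrix_transpose_mul M matrix_mul_assoc yy)
       (simp add: matrix_mul_assoc[symmetric] yy scaleR_2)
  \<comment> \<open>Along \<open>y ** M\<close> the Gram matrix has derivative
    \<open>2 *\<^sub>R M\<close>, so the correction term contributes exactly minus the first order
    change of \<open>f\<close>.\<close>
  have "nabla (merit f \<gamma>) y \<bullet> (y ** M) = 0"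
    unfolding nabla_merit_inner[OF f H] eq by (simp add: D matrix_mult_linear)
  moreover have "y \<in> safety_region \<epsilon>" using y stiefel_subset_safety[OF \<epsilon>] by blast
  moreover from this have "merit f \<gamma> x \<le> merit f \<gamma> y + nabla (merit f \<gamma>) y \<bullet> (x - y) + C / 2 * (norm (x - y))\<^sup>2"
    using ub x unfolding quadratic_upper_bound_on_def by blast
  ultimately show ?thesis
    unfolding M(1) norm_stiefel_mult[OF y] merit_stiefel[OF y] by simp
qed

text \<open>With \<open>u = sqrt (1 - \<epsilon>)\<close> the denominator is
  \<open>3 - 4 * \<epsilon>\<close>. Of the \<open>8 / 32 * \<gamma> * (1 + u)\<^sup>2\<close> on
  the right, \<open>7 / 32\<close> pays for \<open>L\<close> and \<open>s\<close>, and the last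
  \<open>1 / 32\<close> still covers \<open>\<gamma> / 128\<close>.\<close>

lemma merit_lower_scalar_inequality:
  fixes u L s \<gamma> :: real
  assumes u: "1 / 2 < u" "u \<le> 1" and L: "0 \<le> L" and s: "0 \<le> s"
    and \<gamma>: "\<gamma> \<ge> 2 / (4 * u\<^sup>2 - 1) * (L * u\<^sup>2 + 3 * s)"
  shows "L / 2 + s * (1 / u + 1 / 2) + \<gamma> / 128 \<le> \<gamma> / 4 * (1 + u)\<^sup>2"
proof -
  have k: "4 * u\<^sup>2 - 1 > 0"
    using power_strict_mono[of "1 / 2" u 2] u by (simp add: power2_eq_square)
  have uu: "u\<^sup>2 \<le> 3 / 2 * u - 1 / 2"
    using mult_nonneg_nonneg[of "u - 1 / 2" "1 - u"] u by (simp add: field_simps power2_eq_square)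
  have u2: "u\<^sup>2 \<le> u" and u3: "u ^ 3 \<le> u"
    using u power_decreasing[of 1 2 u] power_decreasing[of 1 3 u] by auto
  have "0 \<le> L * u\<^sup>2 + 3 * s" using L s by simp
  then have "0 \<le> 2 / (4 * u\<^sup>2 - 1) * (L * u\<^sup>2 + 3 * s)" using k by simp
  then have \<gamma>0: "\<gamma> \<ge> 0" using \<gamma> by linarith
  \<comment> \<open>The square of \<open>u\<^sup>2 + u\<close> is bounded below by its tangent line
    at \<open>7 / 5\<close>; what remains is a quadratic inequality settled by the chord bound
    \<open>uu\<close>.\<close>
  have "0 \<le> (u\<^sup>2 + u - 7 / 5)\<^sup>2" by simp
  then have "4 * (4 * u\<^sup>2 - 1) \<le> 7 / 2 * ((1 + u)\<^sup>2 * u\<^sup>2)"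
    using uu u by (simp add: power2_eq_square algebra_simps)
  then have L1: "1 / 2 \<le> 7 / 16 * (1 + u)\<^sup>2 / (4 * u\<^sup>2 - 1) * u\<^sup>2"
    using k by (simp add: field_simps)
  have "(1 / u + 1 / 2) * (4 * u\<^sup>2 - 1) \<le> 7 / 16 * (1 + u)\<^sup>2 * 3"
  proof -
    have "(16 + 8 * u) * (4 * u\<^sup>2 - 1) \<le> 21 * u * (1 + u)\<^sup>2"
    proof -
      have "22 * u\<^sup>2 + 11 * u ^ 3 \<le> 16 + 29 * u" using u(2) u2 u3 by linarith
      then show ?thesis by (simp add: power2_eq_square power3_eq_cube algebra_simps)
    qed
    then show ?thesis using u by (simp add: field_simps)
  qed
  then have s1: "1 / u + 1 / 2 \<le> 7 / 16 * (1 + u)\<^sup>2 / (4 * u\<^sup>2 - 1) * 3"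
    by (subst (asm) pos_le_divide_eq[OF k, symmetric]) simp
  have "L / 2 + s * (1 / u + 1 / 2)
      \<le> L * (7 / 16 * (1 + u)\<^sup>2 / (4 * u\<^sup>2 - 1) * u\<^sup>2) + s * (7 / 16 * (1 + u)\<^sup>2 / (4 * u\<^sup>2 - 1) * 3)"
    using mult_left_mono[OF L1 L] mult_left_mono[OF s1 s] by linarith
  also have "\<dots> = 7 / 32 * (1 + u)\<^sup>2 * (2 / (4 * u\<^sup>2 - 1) * (L * u\<^sup>2 + 3 * s))"
  proof -
    have "L * (7 / 16 * a / k * b) + s * (7 / 16 * a / k * 3) = 7 / 32 * a * (2 / k * (L * b + 3 * s))"
      for a b k :: real
      by (cases "k = 0") (simp_all add: field_simps)
    then show ?thesis .
  qed
  also have "\<dots> \<le> 7 / 32 * (1 + u)\<^sup>2 * \<gamma>" by (rule mult_left_mono[OF \<gamma>]) simp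
  finally have "L / 2 + s * (1 / u + 1 / 2) \<le> 7 / 32 * ((1 + u)\<^sup>2 * \<gamma>)" by simp
  moreover have "1 / 4 * \<gamma> \<le> (1 + u)\<^sup>2 * \<gamma>"
  proof (rule mult_right_mono[OF _ \<gamma>0])
    have "1 \<le> (1 + u)\<^sup>2" using u by (intro one_le_power) simp
    then show "1 / 4 \<le> (1 + u)\<^sup>2" by linarith
  qed
  ultimately show ?thesis by (simp add: algebra_simps)
qed

text \<open>Expanding \<open>f\<close> at \<open>x\<close> gives the first order term
  \<open>?S \<bullet> N\<close>. As \<open>N\<close> is minus half the Gram defect up to second
  order, the correction term of the merit function cancels its leading part. The penalty absorbs the
  remainder, because the defect has norm at least \<open>(1 + u) * norm M\<close>.\<close>

lemma stiefel_value_le_merit: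
  fixes x y :: "real ^ 'r ^ 'd"
  assumes \<epsilon>: "0 \<le> \<epsilon>" "\<epsilon> < 3 / 4" and u: "u = sqrt (1 - \<epsilon>)"
    and L: "quadratic_upper_bound_on L UNIV f" "0 \<le> L"
    and s: "norm (symm (transpose x ** nabla f x)) \<le> s"
    and \<gamma>: "\<gamma> \<ge> 2 / (3 - 4 * \<epsilon>) * (L * (1 - \<epsilon>) + 3 * s)"
    and y: "y \<in> stiefel" and M: "x - y = y ** M"
    and N: "transpose N = N" "y - x = x ** N"
    and MD: "(1 + u) * norm M \<le> norm (gram_defect x)"
    and ND: "norm (N + (1 / 2) *\<^sub>R gram_defect x) \<le> (1 / u + 1 / 2) * (norm M)\<^sup>2"
  shows "f y + \<gamma> / 128 * (norm M)\<^sup>2 \<le> merit f \<gamma> x"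
proof -
  let ?D = "gram_defect x" and ?S = "symm (transpose x ** nabla f x)" and ?m = "norm M"
  have s0: "0 \<le> s" using s norm_ge_zero order_trans by blast
  have "sqrt (1 - \<epsilon>) > sqrt (1 / 4)" using \<epsilon> by (intro real_sqrt_less_mono) auto
  then have u1: "1 / 2 < u" "u \<le> 1" using \<epsilon> by (auto simp: u real_sqrt_divide)
  have uu: "u\<^sup>2 = 1 - \<epsilon>" using \<epsilon> by (simp add: u)
  then have "\<epsilon> = 1 - u\<^sup>2" by simp
  with \<gamma> have "\<gamma> \<ge> 2 / (4 * u\<^sup>2 - 1) * (L * u\<^sup>2 + 3 * s)" by simp
  from merit_lower_scalar_inequality[OF u1 L(2) s0 this]
  have scal: "(L / 2 + s * (1 / u + 1 / 2) + \<gamma> / 128) * ?m\<^sup>2 \<le> \<gamma> / 4 * (1 + u)\<^sup>2 * ?m\<^sup>2"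
    by (rule mult_right_mono) simp
  have "0 \<le> 2 / (3 - 4 * \<epsilon>) * (L * (1 - \<epsilon>) + 3 * s)" using \<epsilon> L(2) s0 by simp
  then have \<gamma>0: "\<gamma> \<ge> 0" using \<gamma> by linarith
  have "((1 + u) * ?m)\<^sup>2 \<le> (norm ?D)\<^sup>2" using MD u1 by (intro power_mono) auto
  then have pen: "\<gamma> / 4 * (1 + u)\<^sup>2 * ?m\<^sup>2 \<le> \<gamma> / 4 * (norm ?D)\<^sup>2"
    using \<gamma>0 by (simp add: power_mult_distrib mult.assoc mult_left_mono)
  have nyx: "norm (x ** N) = ?m"
    using M norm_stiefel_mult[OF y, of M] unfolding N(2)[symmetric] by (simp add: norm_minus_commute[of y])
  have "f y \<le> f x + nabla f x \<bullet> (x ** N) + L / 2 * ?m\<^sup>2"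
    using L(1)[unfolded quadratic_upper_bound_on_def, rule_format, OF UNIV_I UNIV_I, of y x]
    unfolding N(2) nyx .
  moreover have "nabla f x \<bullet> (x ** N) = ?S \<bullet> N" by (rule symm_inner_eq[OF N(1), symmetric])
  moreover have "nabla f x \<bullet> (x ** ?D) = ?S \<bullet> ?D"
    by (rule symm_inner_eq[OF transpose_gram_defect, symmetric])
  moreover have "?S \<bullet> (N + (1 / 2) *\<^sub>R ?D) \<le> s * (1 / u + 1 / 2) * ?m\<^sup>2"
  proof -
    have "?S \<bullet> (N + (1 / 2) *\<^sub>R ?D) \<le> norm ?S * norm (N + (1 / 2) *\<^sub>R ?D)"
      by (rule norm_cauchy_schwarz)
    also have "\<dots> \<le> s * ((1 / u + 1 / 2) * ?m\<^sup>2)" by (intro mult_mono s ND s0) simp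
    finally show ?thesis by (simp add: mult.assoc)
  qed
  ultimately show ?thesis
    using scal pen unfolding merit_eq by (simp add: inner_add_right ring_distribs)
qed

lemma mu_prime_bounds:
  assumes "\<mu> > 0" "lam > 0" "0 \<le> \<epsilon>" "\<epsilon> < 1" "2 * lam \<le> C"
  shows "0 < mu_prime \<mu> K C \<epsilon> lam" "mu_prime \<mu> K C \<epsilon> lam \<le> lam"
proof -
  define c where "c = max (1 / \<mu>) ((2 * (3 + 2 * \<epsilon>)\<^sup>2 * K\<^sup>2 + \<mu> * C) / (2 * \<mu> * lam\<^sup>2 * (1 - \<epsilon>)\<^sup>2))"
  have c: "mu_prime \<mu> K C \<epsilon> lam = 1 / c" by (simp add: mu_prime_def c_def)
  have "c \<ge> 1 / \<mu>" by (simp add: c_def)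
  then have c0: "c > 0" using assms(1) by (meson divide_pos_pos less_le_trans zero_less_one)
  then show "0 < mu_prime \<mu> K C \<epsilon> lam" by (simp add: c)
  have "(1 - \<epsilon>)\<^sup>2 \<le> 1\<^sup>2" using assms by (intro power_mono) auto
  then have "2 * \<mu> * lam\<^sup>2 * (1 - \<epsilon>)\<^sup>2 \<le> 2 * \<mu> * lam\<^sup>2 * 1"
    using assms by (intro mult_left_mono) auto
  also have "\<dots> \<le> lam * (2 * (3 + 2 * \<epsilon>)\<^sup>2 * K\<^sup>2 + \<mu> * C)"
  proof -
    have "lam * \<mu> * (2 * lam) \<le> lam * \<mu> * C" using assms by (intro mult_left_mono) auto
    moreover have "0 \<le> lam * (2 * (3 + 2 * \<epsilon>)\<^sup>2 * K\<^sup>2)" using assms by simp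
    ultimately show ?thesis by (simp add: algebra_simps power2_eq_square)
  qed
  finally have "1 / lam \<le> (2 * (3 + 2 * \<epsilon>)\<^sup>2 * K\<^sup>2 + \<mu> * C) / (2 * \<mu> * lam\<^sup>2 * (1 - \<epsilon>)\<^sup>2)"
    using assms by (simp add: divide_simps mult_ac)
  also have "\<dots> \<le> c" by (simp add: c_def)
  finally show "mu_prime \<mu> K C \<epsilon> lam \<le> lam" using assms c0 by (simp add: c field_simps)
qed

text \<open>A Polyak-Lojasiewicz inequality for the merit function. After splitting the square of
  the gradient bound, the two entries of the maximum in \<open>mu_prime\<close> are the ratios of
  the coefficients of \<open>(norm (rgrad f x))\<^sup>2\<close> and \<open>m\<^sup>2\<close> to
  those available in the squared norm of the landing field.\<close>

lemma merit_PL: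
  fixes x y :: "real ^ 'r ^ 'd"
  assumes \<mu>: "\<mu> > 0" and lam: "lam > 0" and \<epsilon>: "0 \<le> \<epsilon>" "\<epsilon> < 1" and K: "0 \<le> K" and C: "2 * lam \<le> C"
    and x: "x \<in> safety_region \<epsilon>"
    and up: "merit f \<gamma> x \<le> f y + C / 2 * m\<^sup>2"
    and m: "0 \<le> m" "m \<le> norm (gram_defect x)"
    and gr: "norm (rgrad f y) \<le> norm (rgrad f x) + (3 + 2 * \<epsilon>) * K * m"
    and pl: "f y \<le> 0 \<or> f y \<le> 1 / (2 * \<mu>) * (norm (rgrad f y))\<^sup>2"
  shows "mu_prime \<mu> K C \<epsilon> lam * merit f \<gamma> x \<le> (norm (landing f lam x))\<^sup>2"
proof -
  define c where "c = max (1 / \<mu>) ((2 * (3 + 2 * \<epsilon>)\<^sup>2 * K\<^sup>2 + \<mu> * C) / (2 * \<mu> * lam\<^sup>2 * (1 - \<epsilon>)\<^sup>2))"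
  have c: "mu_prime \<mu> K C \<epsilon> lam = 1 / c" by (simp add: mu_prime_def c_def)
  have c1: "c \<ge> 1 / \<mu>" by (simp add: c_def)
  then have c0: "c > 0" using \<mu> by (meson divide_pos_pos less_le_trans zero_less_one)
  let ?a = "norm (rgrad f x)" and ?b = "(3 + 2 * \<epsilon>) * K * m"
  have "(2 * (3 + 2 * \<epsilon>)\<^sup>2 * K\<^sup>2 + \<mu> * C) / (2 * \<mu> * lam\<^sup>2 * (1 - \<epsilon>)\<^sup>2) \<le> c" by (simp add: c_def)
  then have c2: "((3 + 2 * \<epsilon>) * K)\<^sup>2 / \<mu> + C / 2 \<le> c * (lam\<^sup>2 * (1 - \<epsilon>)\<^sup>2)"
    unfolding power_mult_distrib using \<mu> lam \<epsilon> by (simp add: field_simps)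
  have "f y \<le> 1 / (2 * \<mu>) * (?a + ?b)\<^sup>2"
  proof (cases "f y \<le> 0")
    case True
    also have "0 \<le> 1 / (2 * \<mu>) * (?a + ?b)\<^sup>2" using \<mu> by simp
    finally show ?thesis .
  next
    case False
    then have "f y \<le> 1 / (2 * \<mu>) * (norm (rgrad f y))\<^sup>2" using pl by simp
    also have "\<dots> \<le> 1 / (2 * \<mu>) * (?a + ?b)\<^sup>2"
      using gr \<mu> by (intro mult_left_mono power_mono) auto
    finally show ?thesis .
  qed
  also have "(?a + ?b)\<^sup>2 \<le> 2 * (?a\<^sup>2 + ?b\<^sup>2)"
    using zero_le_power2[of "?a - ?b"] by (simp add: power2_sum power2_diff)
  finally have "f y \<le> 1 / \<mu> * (?a\<^sup>2 + ?b\<^sup>2)" using \<mu> by (simp add: mult_left_mono field_simps)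
  also have "?b\<^sup>2 = ((3 + 2 * \<epsilon>) * K)\<^sup>2 * m\<^sup>2" by (rule power_mult_distrib)
  finally have "merit f \<gamma> x \<le> 1 / \<mu> * ?a\<^sup>2 + (((3 + 2 * \<epsilon>) * K)\<^sup>2 / \<mu> + C / 2) * m\<^sup>2"
    using up unfolding distrib_left distrib_right by simp
  also have "\<dots> \<le> c * ?a\<^sup>2 + c * (lam\<^sup>2 * (1 - \<epsilon>)\<^sup>2) * m\<^sup>2"
    by (intro add_mono mult_right_mono c1 c2) auto
  also have "\<dots> = c * (?a\<^sup>2 + lam\<^sup>2 * ((1 - \<epsilon>)\<^sup>2 * m\<^sup>2))" by (simp add: algebra_simps)
  also have "\<dots> \<le> c * (?a\<^sup>2 + lam\<^sup>2 * (norm (x ** gram_defect x))\<^sup>2)"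
  proof -
    have "(1 - \<epsilon>)\<^sup>2 * m\<^sup>2 \<le> (1 - \<epsilon>) * (norm (gram_defect x))\<^sup>2"
      using \<epsilon> m by (intro mult_mono power_mono) (auto simp: power2_eq_square mult_left_le)
    also have "\<dots> \<le> (norm (x ** gram_defect x))\<^sup>2" by (rule norm_mult_bounds(2)[OF x])
    finally show ?thesis using c0 by (intro mult_left_mono add_left_mono) auto
  qed
  finally have "merit f \<gamma> x \<le> c * (norm (landing f lam x))\<^sup>2" by (simp add: norm_landing)
  then show ?thesis using c0 by (simp add: c field_simps)
qed

text \<open>On the ray through \<open>z\<close> the skew part of the field is orthogonal to
  \<open>z\<close>, so the radial change of the field comes from the penalty alone. Dividing by
  \<open>t - 1\<close> leaves \<open>lam * (t + 1) * t\<close>. The bound yields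
  \<open>L' > 0\<close> and, via \<open>mu_prime_bounds\<close>,
  \<open>\<mu>' \<le> lam\<close>.\<close>

lemma lipschitz_landing_ge:
  fixes f :: "real ^ 'r ^ 'd \<Rightarrow> real"
  assumes C: "C-lipschitz_on (safety_region \<epsilon>) (landing f lam)" and lam: "lam > 0" and \<epsilon>: "\<epsilon> > 0"
    and z: "(z :: real ^ 'r ^ 'd) \<in> stiefel"
  shows "2 * lam \<le> C"
proof -
  define n where "n = norm (mat 1 :: real ^ 'r ^ 'r)"
  have "(mat 1 :: real ^ 'r ^ 'r) \<noteq> 0" by (simp add: mat_def vec_eq_iff)
  then have n: "n > 0" by (simp add: n_def)
  have z0: "z \<noteq> 0"
    using z \<open>mat 1 \<noteq> 0\<close> by (auto simp: stiefel_def transpose_def matrix_matrix_mult_def zero_vec_def)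
  \<comment> \<open>This scaling gives the Gram defect norm exactly \<epsilon>, so
    \<open>t *\<^sub>R z\<close> is on the boundary of the safety region.\<close>
  define t where "t = sqrt (1 + \<epsilon> / n)"
  have tt: "t\<^sup>2 - 1 = \<epsilon> / n" using n \<epsilon> by (simp add: t_def)
  have t: "t > 1" using n \<epsilon> by (simp add: t_def)
  have D: "gram_defect (t *\<^sub>R z) = (t\<^sup>2 - 1) *\<^sub>R mat 1"
    using z by (simp add: gram_defect_def transpose_linear matrix_mult_linear stiefel_def
        power2_eq_square algebra_simps)
  then have tz: "t *\<^sub>R z \<in> safety_region \<epsilon>"
    using n \<epsilon> by (simp add: safety_region_eq tt n_def[symmetric])
  have zs: "z \<in> safety_region \<epsilon>" using z stiefel_subset_safety[of \<epsilon>] \<epsilon> by (meson less_imp_le subsetD)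
  have skew0: "(skew B ** w) \<bullet> w = 0" for B and w :: "real ^ 'r ^ 'd"
    using inner_skew_mult_sym[OF transpose_skew[of B], of "mat 1" w] by simp
  have "landing f lam z \<bullet> z = 0"
    using z skew0 by (simp add: landing_eq stiefel_eq)
  moreover have "landing f lam (t *\<^sub>R z) \<bullet> (t *\<^sub>R z) = lam * ((t\<^sup>2 - 1) * (t * t * (z \<bullet> z)))"
    unfolding landing_eq inner_add_left skew0 D by (simp add: matrix_mult_linear mult_ac)
  then have "landing f lam (t *\<^sub>R z) \<bullet> z = lam * ((t\<^sup>2 - 1) * (t * (z \<bullet> z)))"
    using t by simp
  ultimately have "lam * ((t\<^sup>2 - 1) * (t * (norm z)\<^sup>2)) = (landing f lam (t *\<^sub>R z) - landing f lam z) \<bullet> z"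
    by (simp add: inner_diff_left power2_norm_eq_inner)
  also have "\<dots> \<le> norm (landing f lam (t *\<^sub>R z) - landing f lam z) * norm z"
    by (rule norm_cauchy_schwarz)
  also have "\<dots> \<le> C * norm (t *\<^sub>R z - z) * norm z"
    using lipschitz_onD[OF C tz zs] by (simp add: dist_norm mult_right_mono)
  also have "norm (t *\<^sub>R z - z) = (t - 1) * norm z"
    using t by (metis abs_of_pos diff_gt_0_iff_gt norm_scaleR scaleR_diff_left scaleR_one)
  finally have "(lam * ((t + 1) * t)) * ((t - 1) * (norm z)\<^sup>2) \<le> C * ((t - 1) * (norm z)\<^sup>2)"
    by (simp add: power2_eq_square algebra_simps)
  then have "lam * ((t + 1) * t) \<le> C" using t z0 by simp
  moreover have "2 * 1 \<le> (t + 1) * t" using t by (intro mult_mono) auto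
  then have "lam * 2 \<le> lam * ((t + 1) * t)" using lam by simp
  ultimately show ?thesis by simp
qed

section \<open>Linear convergence\<close>

text \<open>A step length is bounded by the decrease of the square root of the merit value, so the
  lengths telescope. Factor \<open>P - Q\<close> into the difference and the sum of the roots, bound
  the sum by \<open>2 * w / sqrt \<mu>\<close>, and cancel one \<open>w\<close>.\<close>

lemma sqrt_length_step:
  fixes P Q \<alpha> \<rho> \<mu> w :: real
  assumes pos: "0 < \<alpha>" "0 < \<rho>" "0 < \<mu>" and Q: "0 \<le> Q" and w: "0 \<le> w"
    and QP: "Q \<le> P - \<alpha> * \<rho> / 2 * w\<^sup>2" and PL: "\<mu> * P \<le> w\<^sup>2"
  shows "\<alpha> * w \<le> 4 / (\<rho> * sqrt \<mu>) * (sqrt P - sqrt Q)"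
proof -
  have QP': "Q \<le> P" using QP pos by (smt (verit) mult_nonneg_nonneg divide_nonneg_nonneg zero_le_power2)
  then have P: "0 \<le> P" using Q by simp
  have "sqrt \<mu> * sqrt P \<le> w" using PL w by (simp add: real_sqrt_mult[symmetric] real_le_lsqrt)
  moreover have "sqrt Q \<le> sqrt P" using QP' by simp
  ultimately have pq: "sqrt \<mu> * (sqrt P + sqrt Q) \<le> 2 * w"
    using pos by (smt (verit) distrib_left mult_left_mono real_sqrt_ge_zero)
  have "sqrt \<mu> * (\<alpha> * \<rho> / 2 * w\<^sup>2) \<le> sqrt \<mu> * (P - Q)" using QP pos by (intro mult_left_mono) auto
  also have "\<dots> = (sqrt P - sqrt Q) * (sqrt \<mu> * (sqrt P + sqrt Q))"
  proof -
    have "P - Q = (sqrt P - sqrt Q) * (sqrt P + sqrt Q)" using P Q by (simp add: algebra_simps)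
    then show ?thesis by simp
  qed
  also have "\<dots> \<le> (sqrt P - sqrt Q) * (2 * w)"
    using QP' by (intro mult_left_mono[OF pq]) simp
  finally have "(sqrt \<mu> * (\<alpha> * \<rho> / 2 * w)) * w \<le> ((sqrt P - sqrt Q) * 2) * w"
    by (simp add: power2_eq_square mult_ac)
  then have "sqrt \<mu> * (\<alpha> * \<rho> / 2 * w) \<le> (sqrt P - sqrt Q) * 2"
  proof (cases "w = 0")
    case True
    then show ?thesis using QP' by simp
  next
    case False
    then show ?thesis
      using \<open>_ \<le> ((sqrt P - sqrt Q) * 2) * w\<close> w by (auto dest: mult_right_le_imp_le)
  qed
  then show ?thesis using pos by (simp add: field_simps)
qed

theorem mainTheorem1:
  fixes f :: "real ^ 'r ^ 'd \<Rightarrow> real"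
    and x :: "nat \<Rightarrow> real ^ 'r ^ 'd"
    and L fstar \<mu> \<delta> \<epsilon> lam \<gamma> \<rho> L_merit L_landing L' \<mu>' G \<alpha> :: real
  assumes "twice_continuously_differentiable f"
    and "smooth_fun L f"
    and "local_minima f fstar \<noteq> {}"
    and "fstar = 0"
    and "\<mu> > 0" and "\<delta> > 0"
    and "local_PL f fstar \<mu> \<delta>"
    and "0 < \<epsilon>" and "\<epsilon> < 3 / 4"
    and "lam > 0"
    and "\<gamma> \<ge> gamma_bound f L \<epsilon> lam"
    and "\<rho> = rho_const \<gamma> \<epsilon> lam"
    and "quadratic_upper_bound_on L_merit (safety_region \<epsilon>) (merit f \<gamma>)"
    and "L_landing-lipschitz_on (safety_region \<epsilon>) (landing f lam)"
    and "L' = max (L_hat f L \<epsilon>) (max L_landing L_merit)"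
    and "\<mu>' = mu_prime \<mu> (L_hat f L \<epsilon>) L' \<epsilon> lam"
    and "G > 0" and "\<And>z. z \<in> safety_region \<epsilon> \<Longrightarrow> norm (rgrad f z) \<le> G"
    and "x 0 \<in> nbhd (local_minima f fstar) \<delta> \<inter> safety_region \<epsilon>"
    and "merit f \<gamma> (x 0) \<le> \<mu>' * \<rho>\<^sup>2 * \<delta>\<^sup>2 / 16"
    and "0 < \<alpha>" and "\<alpha> \<le> min (\<rho> / L') (alpha_safe G \<epsilon> lam)"
    and "\<And>k. x (Suc k) = x k - \<alpha> *\<^sub>R landing f lam (x k)"
  shows "\<forall>k. merit f \<gamma> (x k) \<le> (1 - \<alpha> * \<rho> * \<mu>' / 2) ^ k * merit f \<gamma> (x 0)"
proof -
  note \<epsilon> = assms(8,9) and lam = assms(10) and \<mu> = assms(5) and \<delta> = assms(6) and \<alpha> = assms(21)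
    and step = assms(23)
  define S where "S = local_minima f fstar"
  define K where "K = L_hat f L \<epsilon>"
  define m where "m k = merit f \<gamma> (x k)" for k
  define v where "v k = norm (landing f lam (x k))" for k
  obtain H where f: "\<And>z. f differentiable (at z)"
    and H: "\<And>z. (nabla f has_derivative blinfun_apply (H z)) (at z)"
    using assms(1) unfolding twice_continuously_differentiable_def by auto
  have L: "L-lipschitz_on UNIV (nabla f)" "quadratic_upper_bound_on L UNIV f"
    using assms(2) by (auto simp: smooth_fun_def)
  then have L0: "0 \<le> L" by (auto dest: lipschitz_on_nonneg)
  have cont: "continuous_on UNIV (nabla f)"
    using H has_derivative_continuous continuous_at_imp_continuous_on by blast
  note gK = norm_nabla_le_L_hat[OF cont, of _ \<epsilon> L, folded K_def]
  note s = norm_symm_le_s_const[OF cont, of _ \<epsilon>]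
  have LK: "L \<le> K" by (simp add: K_def L_hat_def)
  have \<gamma>: "\<gamma> \<ge> 2 / (3 - 4 * \<epsilon>) * (L * (1 - \<epsilon>) + 3 * s_const f \<epsilon> + K\<^sup>2 * ((1 + \<epsilon>)\<^sup>2 / (lam * (1 - \<epsilon>))))"
    using assms(11) by (simp add: gamma_bound_def K_def)
  have \<gamma>': "\<gamma> \<ge> 2 / (3 - 4 * \<epsilon>) * (L * (1 - \<epsilon>) + 3 * s_const f \<epsilon>)"
    by (rule order_trans[OF _ \<gamma>], rule mult_left_mono) (use \<epsilon> lam in auto)

  obtain z :: "real ^ 'r ^ 'd" where "z \<in> stiefel" using assms(3) by (auto simp: local_minima_def)
  then have "2 * lam \<le> L_landing" by (rule lipschitz_landing_ge[OF assms(14) lam \<epsilon>(1)])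
  then have L': "2 * lam \<le> L'" "L_merit \<le> L'" by (auto simp: assms(15))
  have \<mu>': "0 < \<mu>'" "\<mu>' \<le> lam"
    unfolding assms(16) using mu_prime_bounds[OF \<mu> lam _ _ L'(1)] \<epsilon> by auto
  have \<alpha>L: "\<alpha> * L' \<le> \<rho>" using assms(22) L' lam by (simp add: field_simps)
  \<comment> \<open>Positivity of \<rho> comes from the existence of an admissible step
    size.\<close>
  have \<rho>: "0 < \<rho>" using \<alpha>L \<alpha> L' lam by (smt (verit) mult_pos_pos)
  have \<rho>_le: "\<rho> \<le> 1 / 2" "\<rho> \<le> \<gamma> / (4 * lam * (1 + \<epsilon>))" by (auto simp: assms(12) rho_const_def)
  have \<gamma>\<rho>: "4 * lam * \<rho> \<le> \<gamma>"
  proof -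
    have "4 * lam * \<rho> * 1 \<le> 4 * lam * \<rho> * (1 + \<epsilon>)" using lam \<rho> \<epsilon> by (intro mult_left_mono) auto
    also have "\<dots> \<le> \<gamma>"
    proof -
      have "0 < 4 * lam * (1 + \<epsilon>)" using lam \<epsilon> by simp
      then show ?thesis using \<rho>_le(2) by (simp add: pos_le_divide_eq mult_ac)
    qed
    finally show ?thesis by simp
  qed
  \<comment> \<open>The left-hand side will be \<open>1 / c\<^sup>2\<close>. With the growth term
    \<open>\<gamma> / 128 * (norm M)\<^sup>2\<close> this bounds the distance to the polar factor by
    \<open>c * sqrt (m k)\<close>.\<close>
  have \<gamma>\<mu>: "\<rho>\<^sup>2 * \<mu>' / 16 \<le> \<gamma> / 128"
  proof -
    have "\<rho> * (\<rho> * \<mu>') \<le> 1 / 2 * (\<rho> * lam)" using \<rho> \<rho>_le(1) \<mu>' by (intro mult_mono) auto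
    then show ?thesis using \<gamma>\<rho> by (simp add: power2_eq_square mult_ac)
  qed
  define \<theta> where "\<theta> = 1 - \<alpha> * \<rho> * \<mu>' / 2"
  have \<theta>: "0 \<le> \<theta>" "\<theta> \<le> 1"
  proof -
    have "\<alpha> * \<mu>' \<le> \<alpha> * L'" using \<alpha> \<mu>' L' lam by (intro mult_left_mono) auto
    then have "\<alpha> * \<mu>' \<le> 1 / 2" using \<alpha>L \<rho>_le(1) by linarith
    then have "(\<alpha> * \<mu>') * \<rho> \<le> 1 / 2 * (1 / 2)" using \<rho> \<rho>_le(1) by (intro mult_mono) auto
    then show "0 \<le> \<theta>" by (simp add: \<theta>_def mult_ac)
    show "\<theta> \<le> 1" using \<alpha> \<rho> \<mu>' by (simp add: \<theta>_def)
  qed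

  have safe: "x k \<in> safety_region \<epsilon>" for k
  proof (induction k)
    case 0
    then show ?case using assms(19) by simp
  next
    case (Suc k)
    then show ?case
      unfolding step using assms(18)[OF Suc] assms(22) \<epsilon> lam \<alpha> assms(17)
      by (intro safety_region_step) auto
  qed
  have descent: "m (Suc k) \<le> m k - \<alpha> * \<rho> / 2 * (v k)\<^sup>2" for k
  proof -
    let ?g = "nabla (merit f \<gamma>) (x k)"
    have "m (Suc k) \<le> m k + ?g \<bullet> (x (Suc k) - x k) + L_merit / 2 * (norm (x (Suc k) - x k))\<^sup>2"
      using assms(13) safe unfolding quadratic_upper_bound_on_def m_def by blast
    also have "\<dots> = m k - \<alpha> * (?g \<bullet> landing f lam (x k)) + \<alpha> * (\<alpha> * L_merit) / 2 * (v k)\<^sup>2"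
      using \<alpha> by (simp add: step v_def power2_eq_square)
    also have "\<dots> \<le> m k - \<alpha> * (\<rho> * (v k)\<^sup>2) + \<alpha> * \<rho> / 2 * (v k)\<^sup>2"
    proof -
      have "\<rho> * (v k)\<^sup>2 \<le> ?g \<bullet> landing f lam (x k)"
        unfolding assms(12) v_def
        by (rule landing_descent_direction[OF safe \<epsilon> lam f H L(1) LK gK[OF safe] s[OF safe] \<gamma>])
      then have "\<alpha> * (\<rho> * (v k)\<^sup>2) \<le> \<alpha> * (?g \<bullet> landing f lam (x k))"
        using \<alpha> by simp
      moreover have "\<alpha> * L_merit \<le> \<rho>"
        using \<alpha>L mult_left_mono[OF L'(2), of \<alpha>] \<alpha> by linarith
      then have "\<alpha> * (\<alpha> * L_merit) / 2 * (v k)\<^sup>2 \<le> \<alpha> * \<rho> / 2 * (v k)\<^sup>2"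
        using \<alpha> by (intro mult_right_mono divide_right_mono mult_left_mono) auto
      ultimately show ?thesis by linarith
    qed
    finally show ?thesis by (simp add: algebra_simps)
  qed
  have mono: "m (Suc k) \<le> m k" for k
  proof -
    have "0 \<le> \<alpha> * \<rho> / 2 * (v k)\<^sup>2" using \<alpha> \<rho> by simp
    then show ?thesis using descent[of k] by linarith
  qed
  then have le0: "m k \<le> m 0" for k
    by (rule lift_Suc_antimono_le) simp

  define c where "c = 4 / (\<rho> * sqrt \<mu>')"
  have c: "c > 0" using \<rho> \<mu>' by (simp add: c_def)
  have c_sq: "\<rho>\<^sup>2 * \<mu>' / 16 = 1 / c\<^sup>2"
    using \<mu>' by (simp add: c_def power_divide power_mult_distrib)
  \<comment> \<open>The assumption on the initial merit value says that the total length budget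
    \<open>c * sqrt (m 0)\<close> is at most \<delta>.\<close>
  have radius: "c * sqrt (m 0) \<le> \<delta>"
  proof -
    have "(\<delta> / c)\<^sup>2 = \<rho>\<^sup>2 * \<mu>' / 16 * \<delta>\<^sup>2" unfolding c_sq by (simp add: power_divide)
    then have "m 0 \<le> (\<delta> / c)\<^sup>2"
      using assms(20) by (simp add: m_def mult_ac)
    then have "sqrt (m 0) \<le> \<delta> / c"
      using \<delta> c by (intro real_le_lsqrt) auto
    then show ?thesis using c by (simp add: field_simps)
  qed

  have PL: "\<mu>' * m k \<le> (v k)\<^sup>2"
    if k: "0 \<le> m k" "infdist (x k) S \<le> \<delta> + c * (sqrt (m 0) - sqrt (m k))" for k
  proof -
    define u where "u = sqrt (1 - \<epsilon>)"
    note \<epsilon>' = less_imp_le[OF \<epsilon>(1)] \<epsilon>(2)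
    obtain y M N where y: "y \<in> stiefel" and M: "transpose M = M" "x k - y = y ** M"
      and N: "transpose N = N" "y - x k = x k ** N"
      and MD: "(1 + u) * norm M \<le> norm (gram_defect (x k))"
      and ND: "norm (N + (1 / 2) *\<^sub>R gram_defect (x k)) \<le> (1 / u + 1 / 2) * (norm M)\<^sup>2"
      using polar_decomposition[OF safe \<epsilon>' u_def] by metis
    have xy: "norm (x k - y) = norm M" using M(2) norm_stiefel_mult[OF y] by metis
    have "f y \<le> 1 / (2 * \<mu>) * (norm (rgrad f y))\<^sup>2" if "f y > 0"
    proof -
      have "f y + \<gamma> / 128 * (norm M)\<^sup>2 \<le> m k"
        unfolding m_def
        by (rule stiefel_value_le_merit[OF \<epsilon>' u_def L(2) L0 s[OF safe] \<gamma>' y M(2) N MD ND])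
      moreover have "\<rho>\<^sup>2 * \<mu>' / 16 * (norm M)\<^sup>2 \<le> \<gamma> / 128 * (norm M)\<^sup>2"
        by (rule mult_right_mono[OF \<gamma>\<mu>]) simp
      moreover have "(norm M / c)\<^sup>2 = \<rho>\<^sup>2 * \<mu>' / 16 * (norm M)\<^sup>2"
        unfolding c_sq by (simp add: power_divide)
      ultimately have "(norm M / c)\<^sup>2 \<le> m k" using that by linarith
      then have "norm M / c \<le> sqrt (m k)" by (rule real_le_rsqrt)
      then have "norm M \<le> c * sqrt (m k)" using c by (simp add: field_simps)
      moreover have "infdist y S \<le> infdist (x k) S + norm M"
        using infdist_triangle[of y S "x k"] xy by (simp add: dist_norm norm_minus_commute)
      \<comment> \<open>The \<open>c * sqrt (m k)\<close> needed to reach \<open>y\<close> is the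
        part of the budget not yet spent, so the sum is at most
        \<open>\<delta> + c * sqrt (m 0)\<close>.\<close>
      ultimately have "infdist y S \<le> 2 * \<delta>"
        using k(2) radius by (simp add: algebra_simps)
      then have "y \<in> stiefel \<inter> nbhd (local_minima f fstar) (2 * \<delta>)"
        using y by (simp add: nbhd_def S_def)
      then show ?thesis using assms(4,7) unfolding local_PL_def by force
    qed
    then have pl: "f y \<le> 0 \<or> f y \<le> 1 / (2 * \<mu>) * (norm (rgrad f y))\<^sup>2" by linarith
    have up: "m k \<le> f y + L' / 2 * (norm M)\<^sup>2"
    proof -
      have "m k \<le> f y + L_merit / 2 * (norm M)\<^sup>2"
        unfolding m_def by (rule merit_le_stiefel_value[OF assms(13) safe y \<epsilon>'(1) M(2,1) f H])
      moreover have "L_merit / 2 * (norm M)\<^sup>2 \<le> L' / 2 * (norm M)\<^sup>2"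
        using L'(2) by (intro mult_right_mono) auto
      ultimately show ?thesis by linarith
    qed
    have "0 \<le> u * norm M" using \<epsilon> by (simp add: u_def)
    then have MD': "norm M \<le> norm (gram_defect (x k))" using MD by (simp add: algebra_simps)
    have gr: "norm (rgrad f y) \<le> norm (rgrad f (x k)) + (3 + 2 * \<epsilon>) * K * norm M"
      using rgrad_stiefel_le[OF safe[of k] y \<epsilon>'(1) L(1) LK gK[OF safe]] unfolding xy .
    have K0: "0 \<le> K" using L0 LK by simp
    have \<epsilon>1: "\<epsilon> < 1" using \<epsilon> by simp
    show ?thesis
      unfolding assms(16) K_def[symmetric] v_def m_def
      by (rule merit_PL[OF \<mu> lam \<epsilon>'(1) \<epsilon>1 K0 L'(1) safe up[unfolded m_def] norm_ge_zero MD' gr pl])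
  qed

  have "m k \<le> \<theta> ^ k * m 0" for k
  proof (cases "m 0 < 0")
    case True
    \<comment> \<open>For a negative start the factor \<theta> ^ k only raises the right-hand side,
      so monotonicity suffices.\<close>
    then have "1 * m 0 \<le> \<theta> ^ k * m 0"
      using \<theta> by (intro mult_right_mono_neg power_le_one) auto
    then show ?thesis using le0[of k] by simp
  next
    case False
    \<comment> \<open>Decay and distance are proved together, since \<open>PL\<close> needs the
      distance bound. By monotonicity a nonnegative value at \<open>Suc k\<close> forces a
      nonnegative one at \<open>k\<close>, so the second alternative is then available as induction
      hypothesis.\<close>
    have "m k < 0 \<or> 0 \<le> m k \<and> m k \<le> \<theta> ^ k * m 0
        \<and> infdist (x k) S \<le> \<delta> + c * (sqrt (m 0) - sqrt (m k))"
    proof (induction k)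
      case 0
      then show ?case using False assms(19) by (simp add: nbhd_def S_def)
    next
      case (Suc k)
      show ?case
      proof (cases "m (Suc k) < 0")
        case False
        then have k: "0 \<le> m k" "m k \<le> \<theta> ^ k * m 0"
          "infdist (x k) S \<le> \<delta> + c * (sqrt (m 0) - sqrt (m k))"
          using Suc mono[of k] by auto
        note pl = PL[OF k(1,3)]
        have "m (Suc k) \<le> m k - \<alpha> * \<rho> / 2 * (\<mu>' * m k)"
        proof -
          have "0 \<le> \<alpha> * \<rho> / 2" using \<alpha> \<rho> by simp
          from mult_left_mono[OF pl this] descent[of k] show ?thesis by linarith
        qed
        also have "\<dots> = \<theta> * m k" by (simp add: \<theta>_def algebra_simps)
        also have "\<dots> \<le> \<theta> ^ Suc k * m 0" using mult_left_mono[OF k(2) \<theta>(1)] by (simp add: mult.assoc)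
        finally have decay: "m (Suc k) \<le> \<theta> ^ Suc k * m 0" .
        have "dist (x (Suc k)) (x k) = \<alpha> * v k"
          using \<alpha> by (simp add: step v_def dist_norm)
        also have "\<dots> \<le> c * (sqrt (m k) - sqrt (m (Suc k)))"
          unfolding c_def using False
          by (intro sqrt_length_step[OF \<alpha> \<rho> \<mu>'(1) _ _ descent pl]) (auto simp: v_def)
        finally have "infdist (x (Suc k)) S \<le> \<delta> + c * (sqrt (m 0) - sqrt (m (Suc k)))"
          using infdist_triangle[of "x (Suc k)" S "x k"] k(3) by (simp add: algebra_simps)
        then show ?thesis using decay False by simp
      qed simp
    qed
    moreover have "0 \<le> \<theta> ^ k * m 0" using False \<theta> by simp
    ultimately show ?thesis by linarith
  qed
  then show ?thesis unfolding m_def \<theta>_def by blast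
qed

end
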